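(* Let $k$ be a field of characteristic zero, let $R = k[x_1,x_2,x_3,x_4]$, let $2 \le a_1 \le a_2 \le a_3 \le a_4 \le a_5$ be integers, let $L \in R$ be a general linear form, and let $I = \langle x_1^{a_1}, x_2^{a_2}, x_3^{a_3}, x_4^{a_4}, L^{a_5} \rangle$. Assume that $a_1+a_2+a_3+a_4$ is odd, and set $\lambda = \frac{a_1+a_2+a_3+a_4-5}{2}$. Then: (i) If $a_5 \ge \lambda - 1$, then $R/I$ has the WLP. (ii) If $a_5 < \lambda - 1$ and $a_1 + a_4 \ge a_2 + a_3$, then $R/I$ fails the WLP from degree $\lambda - 1$ to degree $\lambda$. These hypotheses force $a_1 \ge 5$. (iii) If $a_5 < \lambda - 1$, $a_1 + a_4 < a_2 + a_3$ and $2a_5 + 3 - a_4 - a_3 - a_2 + a_1 \ge 0$, then $R/I$ fails the WLP from degree $\lambda - 1$ to degree $\lambda$. These hypotheses force $a_1 \ge 3$.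
   Context: "General linear form" means that the assertion holds for all linear forms whose coefficient vector lies in some nonempty Zariski-open subset of the space of linear forms $[R]_1$. A standard graded artinian $k$-algebra $A = R/I$ has the Weak Lefschetz Property (WLP) if, for a general linear form $\ell \in R$, the multiplication map $\times \ell : [A]_{t} \to [A]_{t+1}$ has maximal rank (i.e. is injective or surjective) for every integer $t$. "$A$ fails the WLP from degree $m-1$ to degree $m$" means that for a general linear form $\ell$ the map $\times \ell : [A]_{m-1} \to [A]_m$ does not have maximal rank. *)

theory Defs
  imports Complex_Main "HOL-Library.Poly_Mapping" "HOL-Library.Numeral_Type"
    "HOL-Library.Set_Algebras"
begin

text \<open>
  The polynomial ring with coefficients in \<open>'k\<close> and variables indexed by the finite type \<open>'n\<close>:
  an exponent vector is an element of \<open>'n \<Rightarrow>\<^sub>0 nat\<close>, and a polynomial is a finitely supported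
  family of coefficients. Its ring structure is the convolution product of \<open>Poly_Mapping\<close>.
\<close>

type_synonym ('n, 'k) mpolynomial = "('n \<Rightarrow>\<^sub>0 nat) \<Rightarrow>\<^sub>0 'k"

definition Var :: "'n \<Rightarrow> ('n, 'k::comm_ring_1) mpolynomial" where
  "Var i = Poly_Mapping.single (Poly_Mapping.single i 1) 1"

definition total_deg :: "('n::finite \<Rightarrow>\<^sub>0 nat) \<Rightarrow> nat" where
  "total_deg m = (\<Sum>i\<in>UNIV. Poly_Mapping.lookup m i)"

definition eval_at :: "('n::finite \<Rightarrow> 'k) \<Rightarrow> ('n, 'k::comm_ring_1) mpolynomial \<Rightarrow> 'k" where
  "eval_at c p =
    (\<Sum>m\<in>Poly_Mapping.keys p.
      Poly_Mapping.lookup p m * (\<Prod>i\<in>UNIV. c i ^ Poly_Mapping.lookup m i))"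

text \<open>The graded piece \<open>[R]\<^sub>t\<close>; the degree is an integer, and \<open>[R]\<^sub>t = {0}\<close> for \<open>t < 0\<close>.\<close>

definition homogeneous_part :: "int \<Rightarrow> ('n::finite, 'k::comm_ring_1) mpolynomial set" where
  "homogeneous_part t = {p. \<forall>m\<in>Poly_Mapping.keys p. int (total_deg m) = t}"

definition zariski_open :: "('n::finite \<Rightarrow> 'k::comm_ring_1) set \<Rightarrow> bool" where
  "zariski_open U \<longleftrightarrow>
    (\<exists>S :: ('n, 'k) mpolynomial set. U = {c. \<exists>f\<in>S. eval_at c f \<noteq> 0})"

definition linear_coeffs :: "('n, 'k::comm_ring_1) mpolynomial \<Rightarrow> 'n \<Rightarrow> 'k" where
  "linear_coeffs l = (\<lambda>i. Poly_Mapping.lookup l (Poly_Mapping.single i 1))"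

definition for_general_linear_form ::
    "(('n::finite, 'k::comm_ring_1) mpolynomial \<Rightarrow> bool) \<Rightarrow> bool" where
  "for_general_linear_form P \<longleftrightarrow>
    (\<exists>U. zariski_open U \<and> U \<noteq> {} \<and> (\<forall>l\<in>homogeneous_part 1. linear_coeffs l \<in> U \<longrightarrow> P l))"

text \<open>The ideal generated by a set: its span in the ring, viewed as a module over itself.\<close>

definition ideal_generated :: "'r::comm_ring_1 set \<Rightarrow> 'r set" where
  "ideal_generated B = module.span (*) B"

text \<open>
  For a homogeneous ideal \<open>I\<close>, the elements of \<open>R/I\<close> are the cosets \<open>f +o I\<close>, and \<open>[R/I]\<^sub>t\<close>
  consists of the cosets of forms of degree \<open>t\<close>.
\<close>

definition quotient_part ::
    "('n::finite, 'k::comm_ring_1) mpolynomial set \<Rightarrow> int \<Rightarrow> ('n, 'k) mpolynomial set set" where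
  "quotient_part I t = (\<lambda>f. f +o I) ` homogeneous_part t"

text \<open>Multiplication by the class of \<open>l\<close>: it sends \<open>f +o I\<close> to \<open>(l * f) +o I\<close>, see below.\<close>

definition quotient_mult :: "'r::comm_ring_1 set \<Rightarrow> 'r \<Rightarrow> 'r set \<Rightarrow> 'r set" where
  "quotient_mult I l C = (l *o C) + I"

lemma quotient_mult_coset:
  fixes B :: "'r::comm_ring_1 set"
  defines "I \<equiv> ideal_generated B"
  shows "quotient_mult I l (f +o I) = (l * f) +o I"
proof -
  interpret module "(*) :: 'r \<Rightarrow> 'r \<Rightarrow> 'r"
    by unfold_locales (simp_all add: algebra_simps)
  have add: "x + y \<in> I" if "x \<in> I" "y \<in> I" for x y
    using that unfolding I_def ideal_generated_def by (rule span_add)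
  have mult: "r * x \<in> I" if "x \<in> I" for r x
    using that unfolding I_def ideal_generated_def by (rule span_scale)
  have zero: "0 \<in> I"
    unfolding I_def ideal_generated_def by (rule span_zero)
  show ?thesis
  proof (intro subset_antisym subsetI)
    fix y assume "y \<in> quotient_mult I l (f +o I)"
    then obtain u v where "u \<in> I" "v \<in> I" "y = l * (f + u) + v"
      unfolding quotient_mult_def elt_set_plus_def elt_set_times_def set_plus_def by auto
    moreover from this have "l * u + v \<in> I"
      using add mult by blast
    ultimately have "y = l * f + (l * u + v)" "l * u + v \<in> I"
      by (simp_all add: distrib_left add.assoc)
    then show "y \<in> (l * f) +o I"
      unfolding elt_set_plus_def by blast
  next
    fix y assume "y \<in> (l * f) +o I"
    then obtain v where v: "v \<in> I" "y = l * (f + 0) + v"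
      unfolding elt_set_plus_def by auto
    with zero show "y \<in> quotient_mult I l (f +o I)"
      unfolding quotient_mult_def elt_set_plus_def elt_set_times_def set_plus_def by blast
  qed
qed

definition max_rank ::
    "('n::finite, 'k::comm_ring_1) mpolynomial set \<Rightarrow> ('n, 'k) mpolynomial \<Rightarrow> int \<Rightarrow> bool" where
  "max_rank I l t \<longleftrightarrow>
    inj_on (quotient_mult I l) (quotient_part I t) \<or>
    quotient_mult I l ` quotient_part I t = quotient_part I (t + 1)"

text \<open>The following two notions are meant for homogeneous \<open>I\<close> with \<open>R/I\<close> artinian.\<close>

definition has_WLP :: "('n::finite, 'k::field) mpolynomial set \<Rightarrow> bool" where
  "has_WLP I \<longleftrightarrow> for_general_linear_form (\<lambda>l. \<forall>t. max_rank I l t)"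

text \<open>Failure of the weak Lefschetz property from degree \<open>m - 1\<close> to degree \<open>m\<close>.\<close>

definition fails_WLP_to :: "('n::finite, 'k::field) mpolynomial set \<Rightarrow> int \<Rightarrow> bool" where
  "fails_WLP_to I m \<longleftrightarrow> for_general_linear_form (\<lambda>l. \<not> max_rank I l (m - 1))"

text \<open>
  The four variables are indexed by the numeral type \<open>4\<close>, whose elements are \<open>1, 2, 3\<close>
  and \<open>4\<close>, with \<open>4 = 0\<close>.
\<close>

lemma UNIV_4: "(UNIV :: 4 set) = {1, 2, 3, 4}" "card {1, 2, 3, 4 :: 4} = 4"
proof -
  have "card {1, 2, 3, 4 :: 4} = CARD(4)"
    by simp
  then show "(UNIV :: 4 set) = {1, 2, 3, 4}"
    using card_subset_eq[of "UNIV :: 4 set" "{1, 2, 3, 4}"] by simp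
  show "card {1, 2, 3, 4 :: 4} = 4"
    by simp
qed

definition power_ideal ::
    "nat \<Rightarrow> nat \<Rightarrow> nat \<Rightarrow> nat \<Rightarrow> nat \<Rightarrow> (4, 'k::field) mpolynomial \<Rightarrow> (4, 'k) mpolynomial set" where
  "power_ideal a1 a2 a3 a4 a5 L =
    ideal_generated {Var 1 ^ a1, Var 2 ^ a2, Var 3 ^ a3, Var 4 ^ a4, L ^ a5}"

end

theory Submission
  imports Defs
begin

text \<open>
  Let \<open>l\<close> and \<open>L\<close> be the linear forms with coefficient vectors \<open>b\<close> and \<open>c\<close>, let \<open>J\<close> be the ideal
  generated by the four powers of variables and \<open>A = R/J\<close>. The socle degree of \<open>A\<close> is \<open>2 * lam + 1\<close>,
  so that \<open>lam\<close> is the middle degree. Three ingredients carry the proof.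

  \<^item> The strong Lefschetz property of \<open>A\<close>. The algebra \<open>A\<close> is a tensor product of irreducible
    representations of \<open>sl\<^sub>2\<close> on which \<open>l\<close> acts as the raising operator, so powers of \<open>l\<close> and of \<open>L\<close>
    are injective below the middle and \<open>l\<close> is surjective above it
    (\<open>strong_lefschetz_inj\<close>, \<open>strong_lefschetz_surj\<close>).

  \<^item> Apolarity. A form \<open>F\<close> of degree \<open>t\<close>, viewed as a functional through differentiation, vanishes on
    \<open>J\<close> if its degree in \<open>x\<^sub>i\<close> is less than \<open>a\<^sub>i\<close>; it vanishes on the multiples of \<open>l\<close> if its derivative
    in the direction \<open>b\<close> is zero, and on those of \<open>L ^ a5\<close> if its degree in the direction \<open>c\<close> is less
    than \<open>a5\<close>. Geometrically these \<open>F\<close> are plane curves with prescribed multiplicities at five points,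
    namely the images of the four unit vectors and of \<open>c\<close> modulo \<open>b\<close>.

  \<^item> The conic through the five points. Its \<open>r\<close>-th power times a form \<open>G\<close> of degree \<open>t - 2 * r\<close>
    satisfies the five degree bounds if \<open>G\<close> satisfies the bounds lowered by \<open>r\<close>.

  For the failure of maximal rank take \<open>r = lam - a5\<close>, which is at least \<open>2\<close>. For this \<open>r\<close> the lowered
  bound in the direction \<open>c\<close> only asks that \<open>G\<close> vanish at \<open>c\<close>. Let \<open>N\<close> be the number of monomials of \<open>A\<close> in
  degree \<open>lam\<close> minus that in degree \<open>lam - 1\<close>. Counting lattice points in boxes (\<open>card_box_growth\<close>)
  shows that the forms \<open>G\<close> before the condition at \<open>c\<close> make up a space of dimension at least
  \<open>N - 2 * r\<close>, and that \<open>N - 2 * r\<close> is at least \<open>2\<close>. So a nonzero functional on the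
  component of \<open>R/I\<close> of degree \<open>lam\<close> kills the multiples of \<open>l\<close>, and multiplication by \<open>l\<close> is not
  surjective. On the other hand,
  \<open>[A/l]\<^sub>r\<close> has dimension \<open>(r + 1) * (r + 2) / 2\<close>, and multiplication by \<open>L ^ a5\<close> sends it to a space
  of dimension at most \<open>N - (N - 2 * r - 1) = 2 * r + 1\<close>, which is smaller. So there is a form \<open>u\<close> of
  degree \<open>r\<close>, not divisible by \<open>l\<close>, with \<open>L ^ a5 * u = l * g\<close> in \<open>A\<close>, and the strong Lefschetz property
  for \<open>L\<close> shows that \<open>g\<close> is not in \<open>I\<close>: multiplication by \<open>l\<close> is not injective either.

  If \<open>a5 \<ge> lam - 1\<close>, then up to degree \<open>lam\<close> the ideals \<open>I\<close> and \<open>J\<close> differ at most by the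
  multiples of \<open>L ^ a5\<close> by forms of degree \<open>0\<close> and \<open>1\<close>. Injectivity survives because of explicit
  products of brackets (\<open>bracket_monomial\<close>), the linear forms of lines joining two of the four
  coordinate points: they do not vanish at \<open>c\<close>, and three of them have independent gradients there.
\<close>

section \<open>Partial derivatives, evaluation and the apolarity pairing\<close>

abbreviation const :: "'k \<Rightarrow> ('n, 'k::comm_ring_1) mpolynomial" where
  "const k \<equiv> Poly_Mapping.single 0 k"

lemma poly_induct [case_names single add]:
  fixes p :: "('n, 'k::comm_ring_1) mpolynomial"
  assumes single: "\<And>m k. P (Poly_Mapping.single m k)"
    and add: "\<And>p q. P p \<Longrightarrow> P q \<Longrightarrow> P (p + q)"
  shows "P p"
proof (induction p rule: update_induct)
  case const
  show ?case using single[of 0 0] by simp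
next
  case (update f a b)
  have "Poly_Mapping.update a b f = f + Poly_Mapping.single a b"
    using update(1)
    by (intro poly_mapping_eqI)
      (auto simp: lookup_update lookup_add lookup_single in_keys_iff when_def)
  then show ?case using add[OF update(3) single] by simp
qed

lemma poly_eq_sum_monomials:
  fixes p :: "('n, 'k::comm_ring_1) mpolynomial"
  shows "p = (\<Sum>m\<in>Poly_Mapping.keys p. Poly_Mapping.single m (Poly_Mapping.lookup p m))"
proof (rule poly_mapping_eqI)
  fix n
  have "(\<Sum>m\<in>Poly_Mapping.keys p. Poly_Mapping.lookup (Poly_Mapping.single m (Poly_Mapping.lookup p m)) n)
      = (\<Sum>m\<in>Poly_Mapping.keys p. if m = n then Poly_Mapping.lookup p n else 0)"
    by (intro sum.cong refl) (simp add: lookup_single when_def)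
  also have "\<dots> = Poly_Mapping.lookup p n"
    by (simp add: in_keys_iff)
  finally show "Poly_Mapping.lookup p n =
      Poly_Mapping.lookup (\<Sum>m\<in>Poly_Mapping.keys p. Poly_Mapping.single m (Poly_Mapping.lookup p m)) n"
    by (simp add: lookup_sum)
qed

lemma Var_power: "Var i ^ n = Poly_Mapping.single (Poly_Mapping.single i n) 1"
  by (induction n) (simp_all add: Var_def mult_single flip: single_add)

lemma lookup_const_mult: "Poly_Mapping.lookup (const k * p) m = k * Poly_Mapping.lookup p m"
  for p :: "('n, 'k::comm_ring_1) mpolynomial"
  by (induction p rule: poly_induct)
    (simp_all add: mult_single lookup_single when_def distrib_left lookup_add)

lemma single_eq_const_mult: "Poly_Mapping.single m k = const k * Poly_Mapping.single m 1"
  for k :: "'k::comm_ring_1"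
  by (simp add: mult_single)

lemma const_add: "const (a + b) = const a + const b"
  and const_mult: "const (a * b) = const a * const b"
  by (simp_all add: single_add mult_single)

lemma const_diff: "const (a - b) = const a - const b"
  for a :: "'k::comm_ring_1"
  by (simp add: single_diff)

lemma const_sum: "const (\<Sum>i\<in>A. f i) = (\<Sum>i\<in>A. const (f i))"
  by (induction A rule: infinite_finite_induct) (simp_all add: const_add)

subsection \<open>Derivations\<close>

definition derivation :: "('r::comm_ring_1 \<Rightarrow> 'r) \<Rightarrow> bool" where
  "derivation D \<longleftrightarrow> (\<forall>p q. D (p + q) = D p + D q) \<and> (\<forall>p q. D (p * q) = D p * q + p * D q)"

lemma derivationD:
  assumes "derivation D"
  shows derivation_add: "D (p + q) = D p + D q"
    and derivation_mult: "D (p * q) = D p * q + p * D q"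
    and derivation_0: "D 0 = 0"
    and derivation_1: "D 1 = 0"
    and derivation_minus: "D (- p) = - D p"
    and derivation_diff: "D (p - q) = D p - D q"
    and derivation_sum: "D (\<Sum>i\<in>A. f i) = (\<Sum>i\<in>A. D (f i))"
    and derivation_power: "D (p ^ n) = of_nat n * p ^ (n - 1) * D p"
proof -
  show add: "D (p + q) = D p + D q" for p q
    using assms by (simp add: derivation_def)
  show mult: "D (p * q) = D p * q + p * D q" for p q
    using assms by (simp add: derivation_def)
  show zero: "D 0 = 0" using add[of 0 0] by simp
  show one: "D 1 = 0" using mult[of 1 1] by simp
  show minus: "D (- p) = - D p" for p
    using add[of p "-p"] zero by (simp add: eq_neg_iff_add_eq_0 add.commute)
  show "D (p - q) = D p - D q"
    using add[of p "-q"] minus[of q] by simp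
  show "D (\<Sum>i\<in>A. f i) = (\<Sum>i\<in>A. D (f i))"
    by (induction A rule: infinite_finite_induct) (simp_all add: zero add)
  show "D (p ^ n) = of_nat n * p ^ (n - 1) * D p"
  proof (induction n)
    case (Suc n)
    then show ?case
      by (cases n) (simp_all add: mult algebra_simps)
  qed (simp add: one)
qed

text \<open>For the derivative in some direction, this bounds the degree of the restrictions of \<open>f\<close> to the
  lines in that direction (in characteristic zero). All bounds on degrees and multiplicities take
  this form.\<close>

definition degree_along_le :: "('r \<Rightarrow> 'r) \<Rightarrow> nat \<Rightarrow> 'r::comm_ring_1 \<Rightarrow> bool" where
  "degree_along_le D n f \<longleftrightarrow> (D ^^ Suc n) f = 0"

lemma funpow_derivation:
  assumes "derivation D"
  shows "(D ^^ n) 0 = 0" "(D ^^ n) (p + q) = (D ^^ n) p + (D ^^ n) q"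
    "(D ^^ n) (p - q) = (D ^^ n) p - (D ^^ n) q"
  by (induction n) (simp_all add: derivation_0[OF assms] derivation_add[OF assms] derivation_diff[OF assms])

lemma degree_along_le_mono:
  assumes "derivation D" "degree_along_le D m f" "m \<le> n"
  shows "degree_along_le D n f"
proof -
  have "(D ^^ Suc n) f = (D ^^ (n - m)) ((D ^^ Suc m) f)"
    using assms(3) by (simp flip: funpow_add comp_apply[of "D ^^ (n - m)"] add: funpow_swap1)
  then show ?thesis
    using assms by (simp add: degree_along_le_def funpow_derivation)
qed

lemma degree_along_le_diff:
  assumes "derivation D" "degree_along_le D n f" "degree_along_le D n g"
  shows "degree_along_le D n (f - g)"
  using assms by (simp only: degree_along_le_def funpow_derivation) simp

lemma degree_along_le_add:
  assumes "derivation D" "degree_along_le D n f" "degree_along_le D n g"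
  shows "degree_along_le D n (f + g)"
  using assms by (simp only: degree_along_le_def funpow_derivation) simp

lemma degree_along_le_0: "D f = 0 \<Longrightarrow> degree_along_le D 0 f"
  by (simp add: degree_along_le_def)

text \<open>Degrees along a derivation add up under multiplication because of the Leibniz rule: each
  term of the iterated derivative of a product differentiates one of the factors too often.\<close>

lemma degree_along_le_mult:
  assumes D: "derivation D"
  shows "degree_along_le D m f \<Longrightarrow> degree_along_le D n g \<Longrightarrow> degree_along_le D (m + n) (f * g)"
proof (induction "m + n" arbitrary: m n f g rule: less_induct)
  case less
  have left: "(D ^^ (m + n)) (D f * g) = 0"
  proof (cases m)
    case 0
    then have "D f = 0" using less.prems by (simp add: degree_along_le_def)
    then show ?thesis by (simp add: funpow_derivation[OF D])
  next
    case (Suc m')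
    have "degree_along_le D m' (D f)"
      using less.prems Suc by (simp add: degree_along_le_def funpow_swap1)
    from less.hyps[OF _ this less.prems(2)] Suc show ?thesis
      by (simp add: degree_along_le_def)
  qed
  have right: "(D ^^ (m + n)) (f * D g) = 0"
  proof (cases n)
    case 0
    then have "D g = 0" using less.prems by (simp add: degree_along_le_def)
    then show ?thesis by (simp add: funpow_derivation[OF D])
  next
    case (Suc n')
    have "degree_along_le D n' (D g)"
      using less.prems Suc by (simp add: degree_along_le_def funpow_swap1)
    from less.hyps[OF _ less.prems(1) this] Suc show ?thesis
      by (simp add: degree_along_le_def)
  qed
  have "(D ^^ Suc (m + n)) (f * g) = (D ^^ (m + n)) (D f * g + f * D g)"
    by (simp only: funpow_Suc_right comp_apply derivation_mult[OF D])
  then show ?case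
    using left right by (simp add: degree_along_le_def funpow_derivation[OF D])
qed

lemma degree_along_le_power:
  assumes D: "derivation D" and f: "degree_along_le D m f"
  shows "degree_along_le D (n * m) (f ^ n)"
proof (induction n)
  case 0
  show ?case by (simp add: degree_along_le_def derivation_1[OF D])
next
  case (Suc n)
  show ?case using degree_along_le_mult[OF D f Suc] by simp
qed

subsection \<open>Partial derivatives\<close>

definition pd :: "'n \<Rightarrow> ('n, 'k::comm_ring_1) mpolynomial \<Rightarrow> ('n, 'k) mpolynomial" where
  "pd i p = (\<Sum>m\<in>Poly_Mapping.keys p.
     Poly_Mapping.single (m - Poly_Mapping.single i 1)
       (of_nat (Poly_Mapping.lookup m i) * Poly_Mapping.lookup p m))"

lemma pd_add: "pd i (p + q) = pd i p + pd i q"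
  unfolding pd_def
  by (rule setsum_keys_plus_distrib) (simp_all add: distrib_left single_add)

lemma pd_single: "pd i (Poly_Mapping.single m k) =
    Poly_Mapping.single (m - Poly_Mapping.single i 1) (of_nat (Poly_Mapping.lookup m i) * k)"
  by (simp add: pd_def)

lemma pd_mult: "pd i (p * q) = pd i p * q + p * pd i q"
proof (induction p rule: poly_induct)
  case (single m k)
  show ?case
  proof (induction q rule: poly_induct)
    case (single n l)
    have shift: "Poly_Mapping.single (m + n - Poly_Mapping.single i 1) (of_nat (Poly_Mapping.lookup m i) * x)
        = Poly_Mapping.single (m - Poly_Mapping.single i 1 + n) (of_nat (Poly_Mapping.lookup m i) * x)"
      for m n and x :: 'b
    proof (cases "Poly_Mapping.lookup m i = 0")
      case False
      then have "m + n - Poly_Mapping.single i 1 = m - Poly_Mapping.single i 1 + n"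
        by (intro poly_mapping_eqI) (auto simp: lookup_add lookup_minus lookup_single when_def)
      then show ?thesis by simp
    qed simp
    show ?case
      using shift[of m n "k * l"] shift[of n m "k * l"]
      by (simp add: pd_single mult_single lookup_add algebra_simps single_add)
  qed (simp add: pd_add algebra_simps)
qed (simp add: pd_add algebra_simps)

lemma derivation_pd: "derivation (pd i)"
  by (simp add: derivation_def pd_add pd_mult)

lemma pd_const [simp]: "pd i (const k) = 0"
  by (simp add: pd_single)

lemma pd_Var: "pd i (Var j) = (if i = j then 1 else 0)"
  by (simp add: pd_single Var_def lookup_single when_def)

lemma lookup_pd: "Poly_Mapping.lookup (pd i p) m =
    of_nat (Poly_Mapping.lookup m i + 1) * Poly_Mapping.lookup p (m + Poly_Mapping.single i 1)"
proof (induction p rule: poly_induct)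
  case (single n k)
  show ?case
  proof (cases "n = m + Poly_Mapping.single i 1")
    case True
    then show ?thesis
      by (simp add: pd_single lookup_add)
  next
    case False
    have "Poly_Mapping.lookup n i = 0" if "n - Poly_Mapping.single i 1 = m"
    proof (rule ccontr)
      assume "Poly_Mapping.lookup n i \<noteq> 0"
      then have "n = m + Poly_Mapping.single i 1"
        using that by (auto intro!: poly_mapping_eqI simp: lookup_add lookup_minus lookup_single when_def)
      with False show False by simp
    qed
    with False show ?thesis
      by (auto simp: pd_single lookup_single when_def)
  qed
qed (simp add: pd_add lookup_add algebra_simps)

text \<open>The derivative \<open>dir c\<close> in the direction \<open>c\<close> and multiplication by the linear form \<open>lform c\<close> with
  the same coefficients will be adjoint to each other under the apolarity pairing.\<close>

definition dir :: "('n::finite \<Rightarrow> 'k) \<Rightarrow> ('n, 'k::comm_ring_1) mpolynomial \<Rightarrow> ('n, 'k) mpolynomial" where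
  "dir c p = (\<Sum>i\<in>UNIV. const (c i) * pd i p)"

definition lform :: "('n::finite \<Rightarrow> 'k) \<Rightarrow> ('n, 'k::comm_ring_1) mpolynomial" where
  "lform c = (\<Sum>i\<in>UNIV. const (c i) * Var i)"

lemma derivation_dir: "derivation (dir c)"
  by (simp add: derivation_def dir_def pd_add pd_mult algebra_simps sum.distrib sum_distrib_left)

lemma dir_const [simp]: "dir c (const k) = 0"
  by (simp add: dir_def)

lemma dir_const_mult: "dir c (const k * p) = const k * dir c p"
  by (simp add: derivation_mult[OF derivation_dir])

lemma dir_Var: "dir c (Var i) = const (c i)"
  by (simp add: dir_def pd_Var if_distrib[of "(*) _"] cong: if_cong)

lemma pd_lform: "pd i (lform b) = const (b i)"
  by (simp add: lform_def derivation_sum[OF derivation_pd] pd_mult pd_Var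
      if_distrib[of "(*) _"] cong: if_cong)

lemma pd_eq_dir: "pd i = dir (\<lambda>j. if j = i then 1 else 0)"
proof
  fix p
  have "const (if j = i then 1 else 0) * pd j p = (if j = i then pd i p else 0)" for j
    by simp
  then show "pd i p = dir (\<lambda>j. if j = i then 1 else 0) p"
    by (simp add: dir_def)
qed

subsection \<open>Evaluation\<close>

lemma eval_at_add: "eval_at c (p + q) = eval_at c p + eval_at c q"
  unfolding eval_at_def
  by (rule setsum_keys_plus_distrib) (simp_all add: distrib_right)

lemma eval_at_single: "eval_at c (Poly_Mapping.single m k) = k * (\<Prod>i\<in>UNIV. c i ^ Poly_Mapping.lookup m i)"
  by (simp add: eval_at_def)

lemma eval_at_const [simp]: "eval_at c (const k) = k"
  by (simp add: eval_at_single)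

lemma eval_at_1 [simp]: "eval_at c 1 = 1"
  using eval_at_const[of c 1] by simp

lemma eval_at_0 [simp]: "eval_at c 0 = 0"
  by (simp add: eval_at_def)

lemma eval_at_mult: "eval_at c (p * q) = eval_at c p * eval_at c q"
proof (induction p rule: poly_induct)
  case (single m k)
  show ?case
  proof (induction q rule: poly_induct)
    case (single n l)
    show ?case
      by (simp add: eval_at_single mult_single lookup_add power_add prod.distrib)
  qed (simp add: eval_at_add algebra_simps)
qed (simp add: eval_at_add algebra_simps)

lemma eval_at_minus: "eval_at c (- p) = - eval_at c p"
  using eval_at_add[of c p "- p"] by (simp add: eq_neg_iff_add_eq_0 add.commute)

lemma eval_at_diff: "eval_at c (p - q) = eval_at c p - eval_at c q"
  using eval_at_add[of c p "- q"] by (simp add: eval_at_minus)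

lemma eval_at_sum: "eval_at c (\<Sum>i\<in>A. f i) = (\<Sum>i\<in>A. eval_at c (f i))"
  by (induction A rule: infinite_finite_induct) (simp_all add: eval_at_add)

lemma eval_at_prod: "eval_at c (\<Prod>i\<in>A. f i) = (\<Prod>i\<in>A. eval_at c (f i))"
  by (induction A rule: infinite_finite_induct) (simp_all add: eval_at_mult)

lemma eval_at_power: "eval_at c (p ^ n) = eval_at c p ^ n"
  by (induction n) (simp_all add: eval_at_mult)

lemma eval_at_Var [simp]: "eval_at c (Var i) = c i"
proof -
  have "(\<Prod>j\<in>UNIV. c j ^ Poly_Mapping.lookup (Poly_Mapping.single i 1) j) = (\<Prod>j\<in>UNIV. if j = i then c i else 1)"
    by (intro prod.cong) (auto simp: lookup_single when_def)
  then show ?thesis by (simp add: Var_def eval_at_single)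
qed

subsection \<open>Homogeneous polynomials\<close>

lemma total_deg_add: "total_deg (m + n) = total_deg m + total_deg n"
  by (simp add: total_deg_def lookup_add sum.distrib)

lemma total_deg_single [simp]: "total_deg (Poly_Mapping.single i n) = n"
  by (simp add: total_deg_def lookup_single when_def)

lemma total_deg_eq_0_iff: "total_deg m = 0 \<longleftrightarrow> m = 0"
  unfolding total_deg_def by (simp add: poly_mapping_eq_iff fun_eq_iff)

lemma hom_0 [simp]: "0 \<in> homogeneous_part t"
  by (simp add: homogeneous_part_def)

lemma hom_add: "p \<in> homogeneous_part t \<Longrightarrow> q \<in> homogeneous_part t \<Longrightarrow> p + q \<in> homogeneous_part t"
  using keys_add[of p q] by (auto simp: homogeneous_part_def)

lemma hom_minus: "p \<in> homogeneous_part t \<Longrightarrow> - p \<in> homogeneous_part t"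
  by (auto simp: homogeneous_part_def in_keys_iff)

lemma hom_diff: "p \<in> homogeneous_part t \<Longrightarrow> q \<in> homogeneous_part t \<Longrightarrow> p - q \<in> homogeneous_part t"
  using hom_add[of p t "- q"] hom_minus[of q t] by simp

lemma hom_sum: "(\<And>i. i \<in> A \<Longrightarrow> f i \<in> homogeneous_part t) \<Longrightarrow> (\<Sum>i\<in>A. f i) \<in> homogeneous_part t"
  by (induction A rule: infinite_finite_induct) (simp_all add: hom_add)

lemma hom_mult: "p \<in> homogeneous_part t \<Longrightarrow> q \<in> homogeneous_part u \<Longrightarrow> p * q \<in> homogeneous_part (t + u)"
  unfolding homogeneous_part_def using keys_mult[of p q] by (auto simp: total_deg_add dest!: subsetD)

lemma hom_single: "int (total_deg m) = t \<Longrightarrow> Poly_Mapping.single m k \<in> homogeneous_part t"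
  by (simp add: homogeneous_part_def)

lemma hom_const [simp]: "const k \<in> homogeneous_part 0"
  by (rule hom_single) (simp add: total_deg_def)

lemma hom_1 [simp]: "1 \<in> homogeneous_part 0"
  using hom_const[of 1] by simp

lemma hom_Var [simp]: "Var i \<in> homogeneous_part 1"
  unfolding Var_def by (rule hom_single) simp

lemma hom_const_mult: "p \<in> homogeneous_part t \<Longrightarrow> const k * p \<in> homogeneous_part t"
  using hom_mult[OF hom_const, of p t k] by simp

lemma hom_lform [simp]: "lform c \<in> homogeneous_part 1"
  unfolding lform_def by (intro hom_sum hom_const_mult hom_Var)

lemma hom_power: "p \<in> homogeneous_part t \<Longrightarrow> p ^ n \<in> homogeneous_part (int n * t)"
proof (induction n)
  case (Suc n)
  then show ?case using hom_mult[of p t "p ^ n" "int n * t"] by (simp add: algebra_simps)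
qed simp

lemma hom_pd: "p \<in> homogeneous_part t \<Longrightarrow> pd i p \<in> homogeneous_part (t - 1)"
  unfolding homogeneous_part_def
proof (intro CollectI ballI)
  fix m assume p: "p \<in> {p. \<forall>m\<in>Poly_Mapping.keys p. int (total_deg m) = t}"
    and "m \<in> Poly_Mapping.keys (pd i p)"
  then have "m + Poly_Mapping.single i 1 \<in> Poly_Mapping.keys p"
    by (auto simp: in_keys_iff lookup_pd)
  with p have "int (total_deg (m + Poly_Mapping.single i 1)) = t" by blast
  then show "int (total_deg m) = t - 1" by (simp add: total_deg_add)
qed

lemma hom_dir: "p \<in> homogeneous_part t \<Longrightarrow> dir c p \<in> homogeneous_part (t - 1)"
  unfolding dir_def by (intro hom_sum hom_const_mult hom_pd)

lemma hom_funpow_dir: "p \<in> homogeneous_part t \<Longrightarrow> (dir c ^^ n) p \<in> homogeneous_part (t - int n)"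
proof (induction n)
  case (Suc n)
  then show ?case using hom_dir[of "(dir c ^^ n) p" "t - int n" c] by (simp add: algebra_simps)
qed simp

lemma hom_neg: "p \<in> homogeneous_part t \<Longrightarrow> t < 0 \<Longrightarrow> p = 0"
  by (rule poly_mapping_eqI) (auto simp: homogeneous_part_def in_keys_iff)

lemma hom_0_eq_const:
  assumes "p \<in> homogeneous_part 0"
  shows "p = const (eval_at c p)"
proof -
  have "p = const (Poly_Mapping.lookup p 0)"
  proof (rule poly_mapping_eqI)
    fix m show "Poly_Mapping.lookup p m = Poly_Mapping.lookup (const (Poly_Mapping.lookup p 0)) m"
      using assms by (cases "m = 0")
        (auto simp: homogeneous_part_def total_deg_eq_0_iff lookup_single in_keys_iff)
  qed
  then show ?thesis by (metis eval_at_const)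
qed

lemma hom_1_eq_lform:
  fixes l :: "('n::finite, 'k::comm_ring_1) mpolynomial"
  assumes "l \<in> homogeneous_part 1"
  shows "l = lform (linear_coeffs l)"
proof -
  have one: "\<exists>i. m = Poly_Mapping.single i 1" if "total_deg m = 1" for m :: "'n \<Rightarrow>\<^sub>0 nat"
  proof -
    from that obtain i where i: "Poly_Mapping.lookup m i = 1" "\<forall>j. j \<noteq> i \<longrightarrow> Poly_Mapping.lookup m j = 0"
      unfolding total_deg_def using sum_eq_1_iff[of UNIV "Poly_Mapping.lookup m"] by auto
    then have "m = Poly_Mapping.single i 1"
      by (intro poly_mapping_eqI) (auto simp: lookup_single when_def)
    then show ?thesis by (intro exI)
  qed
  have inj: "Poly_Mapping.single i (Suc 0) = Poly_Mapping.single j (Suc 0) \<longleftrightarrow> i = j" for i j :: 'n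
    by (metis lookup_single_eq lookup_single_not_eq zero_neq_one One_nat_def)
  show ?thesis
  proof (rule poly_mapping_eqI)
    fix m
    have L: "Poly_Mapping.lookup (lform (linear_coeffs l)) m =
        (\<Sum>i\<in>UNIV. linear_coeffs l i * (if Poly_Mapping.single i 1 = m then 1 else 0))"
      by (simp add: lform_def lookup_sum lookup_const_mult Var_def lookup_single when_def)
    show "Poly_Mapping.lookup l m = Poly_Mapping.lookup (lform (linear_coeffs l)) m"
    proof (cases "total_deg m = 1")
      case True
      then obtain i where "m = Poly_Mapping.single i 1" using one by blast
      then show ?thesis
        unfolding L by (simp add: inj linear_coeffs_def if_distrib[of "(*) _"] cong: if_cong)
    next
      case False
      then have "Poly_Mapping.lookup l m = 0"
        using assms by (auto simp: homogeneous_part_def in_keys_iff)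
      moreover have "Poly_Mapping.single i 1 \<noteq> m" for i using False by auto
      ultimately show ?thesis unfolding L by simp
    qed
  qed
qed

lemma euler_identity:
  fixes p :: "('n::finite, 'k::comm_ring_1) mpolynomial"
  assumes "p \<in> homogeneous_part t"
  shows "(\<Sum>i\<in>UNIV. Var i * pd i p) = const (of_int t) * p"
proof (rule poly_mapping_eqI)
  fix m
  have mono: "Poly_Mapping.lookup (Var i * pd i q) m = of_nat (Poly_Mapping.lookup m i) * Poly_Mapping.lookup q m"
    for i and q :: "('n, 'k) mpolynomial"
  proof (induction q rule: poly_induct)
    case (single n k)
    show ?case
    proof (cases "Poly_Mapping.lookup n i = 0")
      case True
      then show ?thesis by (auto simp: pd_single lookup_single when_def)
    next
      case False
      then have "Poly_Mapping.single i 1 + (n - Poly_Mapping.single i 1) = n"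
        by (intro poly_mapping_eqI) (auto simp: lookup_add lookup_minus lookup_single when_def)
      then show ?thesis by (simp add: pd_single Var_def mult_single lookup_single when_def)
    qed
  qed (simp add: pd_add distrib_left lookup_add)
  have "Poly_Mapping.lookup (\<Sum>i\<in>UNIV. Var i * pd i p) m = of_nat (total_deg m) * Poly_Mapping.lookup p m"
    by (simp add: lookup_sum mono total_deg_def sum_distrib_right)
  moreover have "Poly_Mapping.lookup p m = 0 \<or> of_nat (total_deg m) = (of_int t :: 'k)"
  proof (cases "int (total_deg m) = t")
    case True
    then show ?thesis using of_int_of_nat_eq[of "total_deg m", where 'a = 'k] by simp
  next
    case False
    then show ?thesis using assms by (auto simp: homogeneous_part_def in_keys_iff)
  qed
  ultimately show "Poly_Mapping.lookup (\<Sum>i\<in>UNIV. Var i * pd i p) m = Poly_Mapping.lookup (const (of_int t) * p) m"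
    by (auto simp: lookup_const_mult simp del: single_of_int)
qed

text \<open>Differentiating a form \<open>n\<close> times in the direction \<open>c\<close> and evaluating at the point \<open>c\<close> itself
  is, by Euler's identity, evaluation at \<open>c\<close> up to a factorial.\<close>

lemma eval_at_dir_self:
  assumes "p \<in> homogeneous_part t"
  shows "eval_at c (dir c p) = of_int t * eval_at c p"
proof -
  have "eval_at c (dir c p) = eval_at c (\<Sum>i\<in>UNIV. Var i * pd i p)"
    by (simp add: dir_def eval_at_sum eval_at_mult)
  then show ?thesis by (simp add: euler_identity[OF assms] eval_at_mult del: single_of_int)
qed

lemma funpow_dir_self:
  assumes "p \<in> homogeneous_part (int n)"
  shows "(dir c ^^ n) p = const (fact n * eval_at c p)"
proof -
  have "eval_at c ((dir c ^^ n) p) = fact n * eval_at c p"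
    using assms
  proof (induction n arbitrary: p)
    case (Suc n)
    have "dir c p \<in> homogeneous_part (int n)"
      using hom_dir[OF Suc.prems, of c] by simp
    from Suc.IH[OF this] show ?case
      using eval_at_dir_self[OF Suc.prems, of c] by (simp add: funpow_swap1)
  qed simp
  moreover have "(dir c ^^ n) p \<in> homogeneous_part 0"
    using hom_funpow_dir[OF assms, of n c] by simp
  ultimately show ?thesis using hom_0_eq_const[of "(dir c ^^ n) p" c] by simp
qed

subsection \<open>The apolarity pairing\<close>

definition mfact :: "('n::finite \<Rightarrow>\<^sub>0 nat) \<Rightarrow> 'k::field_char_0" where
  "mfact m = (\<Prod>i\<in>UNIV. fact (Poly_Mapping.lookup m i))"

text \<open>The value at \<open>0\<close> of \<open>F\<close> after applying \<open>g\<close> as a differential operator with constant coefficients.\<close>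

definition pairing :: "('n::finite, 'k::field_char_0) mpolynomial \<Rightarrow> ('n, 'k) mpolynomial \<Rightarrow> 'k" where
  "pairing g F = (\<Sum>m\<in>Poly_Mapping.keys g. Poly_Mapping.lookup g m * (mfact m * Poly_Mapping.lookup F m))"

lemma mfact_nonzero [simp]: "mfact m \<noteq> (0::'k::field_char_0)"
  by (simp add: mfact_def)

lemma mfact_add_single: "mfact (m + Poly_Mapping.single i 1) = (of_nat (Poly_Mapping.lookup m i + 1) * mfact m :: 'k::field_char_0)"
proof -
  have "mfact (m + Poly_Mapping.single i 1) =
      (\<Prod>j\<in>UNIV. (if j = i then of_nat (Poly_Mapping.lookup m i + 1) else 1) * (fact (Poly_Mapping.lookup m j) :: 'k))"
    unfolding mfact_def
    by (intro prod.cong refl) (auto simp: lookup_add lookup_single when_def)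
  also have "\<dots> = of_nat (Poly_Mapping.lookup m i + 1) * mfact m"
    by (simp add: prod.distrib mfact_def)
  finally show ?thesis .
qed

lemma pairing_add_left: "pairing (g + h) F = pairing g F + pairing h F"
  unfolding pairing_def
  by (rule setsum_keys_plus_distrib) (simp_all add: distrib_right)

lemma pairing_single: "pairing (Poly_Mapping.single m k) F = k * (mfact m * Poly_Mapping.lookup F m)"
  by (simp add: pairing_def)

lemma pairing_0_left [simp]: "pairing 0 F = 0"
  by (simp add: pairing_def)

lemma pairing_0_right [simp]: "pairing g 0 = 0"
  by (simp add: pairing_def)

lemma pairing_diff_left: "pairing (g - h) F = pairing g F - pairing h F"
  using pairing_add_left[of "g - h" h F] by simp

lemma pairing_sum_left: "pairing (\<Sum>i\<in>A. g i) F = (\<Sum>i\<in>A. pairing (g i) F)"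
  by (induction A rule: infinite_finite_induct) (simp_all add: pairing_add_left)

lemma pairing_const_mult_left: "pairing (const k * g) F = k * pairing g F"
  by (induction g rule: poly_induct)
    (simp_all add: mult_single pairing_single distrib_left pairing_add_left)

lemma pairing_Var_mult: "pairing (Var i * g) F = pairing g (pd i F)"
proof (induction g rule: poly_induct)
  case (single m k)
  show ?case
    by (simp add: Var_def mult_single pairing_single lookup_pd add.commute[of "Poly_Mapping.single i (Suc 0)"]
        mfact_add_single[simplified])
qed (simp add: distrib_left pairing_add_left)

lemma pairing_lform_mult:
  fixes F :: "('n::finite, 'k::field_char_0) mpolynomial"
  shows "pairing (lform c * g) F = pairing g (dir c F)"
proof -
  have right: "pairing g (\<Sum>i\<in>A. const (c i) * G i) = (\<Sum>i\<in>A. c i * pairing g (G i))" for A :: "'n set" and G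
    unfolding pairing_def lookup_sum lookup_const_mult sum_distrib_left
    by (subst sum.swap, intro sum.cong refl) (simp add: mult_ac)
  show ?thesis
    by (simp add: lform_def dir_def right sum_distrib_right pairing_sum_left mult.assoc
        pairing_const_mult_left pairing_Var_mult)
qed

lemma pairing_lform_power_mult: "pairing (lform c ^ n * g) F = pairing g ((dir c ^^ n) F)"
  by (induction n arbitrary: F) (simp_all add: mult.assoc pairing_lform_mult funpow_swap1)

lemma pairing_const_right: "pairing 1 (const k) = k"
  by (simp add: pairing_def mfact_def)

text \<open>In characteristic zero, the degree of \<open>F\<close> in the \<open>i\<close>-th variable is its degree along \<open>pd i\<close>.\<close>

lemma degree_along_pd_keys:
  fixes F :: "('n::finite, 'k::field_char_0) mpolynomial"
  assumes "degree_along_le (pd i) n F" "m \<in> Poly_Mapping.keys F"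
  shows "Poly_Mapping.lookup m i \<le> n"
proof (rule ccontr)
  assume "\<not> Poly_Mapping.lookup m i \<le> n"
  then have le: "Suc n \<le> Poly_Mapping.lookup m i" by simp
  have "Poly_Mapping.lookup ((pd i ^^ q) F) (m - Poly_Mapping.single i q) \<noteq> 0" if "q \<le> Poly_Mapping.lookup m i" for q
    using that
  proof (induction q)
    case 0
    have "m - Poly_Mapping.single i 0 = m" by (simp add: poly_mapping_eq_iff)
    then show ?case using assms(2) by (simp add: in_keys_iff)
  next
    case (Suc q)
    have "m - Poly_Mapping.single i (Suc q) + Poly_Mapping.single i 1 = m - Poly_Mapping.single i q"
      using Suc.prems by (intro poly_mapping_eqI) (auto simp: lookup_add lookup_minus lookup_single when_def)
    then show ?case
      using Suc by (simp add: lookup_pd del: of_nat_add of_nat_Suc)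
  qed
  from this[OF le] assms(1) show False by (simp add: degree_along_le_def)
qed

section \<open>The strong Lefschetz property of monomial complete intersections\<close>

text \<open>The ideal generated by the powers \<open>Var i ^ a i\<close>, described by its monomials.\<close>

definition monomial_ideal :: "('n::finite \<Rightarrow> nat) \<Rightarrow> ('n, 'k::comm_ring_1) mpolynomial set" where
  "monomial_ideal a = {p. \<forall>m\<in>Poly_Mapping.keys p. \<exists>i. a i \<le> Poly_Mapping.lookup m i}"

lemma monomial_ideal_0 [simp]: "0 \<in> monomial_ideal a"
  by (simp add: monomial_ideal_def)

lemma monomial_ideal_add: "p \<in> monomial_ideal a \<Longrightarrow> q \<in> monomial_ideal a \<Longrightarrow> p + q \<in> monomial_ideal a"
  unfolding monomial_ideal_def using keys_add[of p q] by blast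

lemma monomial_ideal_sum: "(\<And>i. i \<in> A \<Longrightarrow> f i \<in> monomial_ideal a) \<Longrightarrow> (\<Sum>i\<in>A. f i) \<in> monomial_ideal a"
  by (induction A rule: infinite_finite_induct) (simp_all add: monomial_ideal_add)

lemma monomial_ideal_mult:
  assumes "p \<in> monomial_ideal a"
  shows "q * p \<in> monomial_ideal a"
  unfolding monomial_ideal_def
proof (intro CollectI ballI)
  fix m assume "m \<in> Poly_Mapping.keys (q * p)"
  then obtain u v where "m = u + v" "v \<in> Poly_Mapping.keys p"
    using keys_mult[of q p] by blast
  with assms show "\<exists>i. a i \<le> Poly_Mapping.lookup m i"
    unfolding monomial_ideal_def by (fastforce simp: lookup_add intro: trans_le_add2)
qed

lemma monomial_ideal_minus: "p \<in> monomial_ideal a \<Longrightarrow> - p \<in> monomial_ideal a"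
  using monomial_ideal_mult[of p a "-1"] by simp

lemma monomial_ideal_diff: "p \<in> monomial_ideal a \<Longrightarrow> q \<in> monomial_ideal a \<Longrightarrow> p - q \<in> monomial_ideal a"
  using monomial_ideal_add[of p a "- q"] monomial_ideal_minus[of q a] by simp

lemma monomial_ideal_const_mult_iff:
  fixes k :: "'k::field"
  assumes "k \<noteq> 0"
  shows "const k * p \<in> monomial_ideal a \<longleftrightarrow> p \<in> monomial_ideal a"
proof
  assume "const k * p \<in> monomial_ideal a"
  then have "const (inverse k) * (const k * p) \<in> monomial_ideal a" by (rule monomial_ideal_mult)
  then show "p \<in> monomial_ideal a" using assms by (simp add: mult_single flip: mult.assoc)
qed (rule monomial_ideal_mult)

lemma single_in_monomial_ideal: "a i \<le> Poly_Mapping.lookup m i \<Longrightarrow> Poly_Mapping.single m k \<in> monomial_ideal a"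
  by (auto simp: monomial_ideal_def)

lemma Var_power_in_monomial_ideal: "Var i ^ a i \<in> monomial_ideal a"
  unfolding Var_power by (rule single_in_monomial_ideal[of _ i]) simp

lemma monomial_ideal_eq_sum:
  assumes "p \<in> monomial_ideal a"
  obtains q where "p = (\<Sum>i\<in>UNIV. Var i ^ a i * q i)"
proof -
  have "\<exists>q. Poly_Mapping.single m k = (\<Sum>i\<in>UNIV. Var i ^ a i * q i)"
    if "a j \<le> Poly_Mapping.lookup m j" for m :: "'a \<Rightarrow>\<^sub>0 nat" and k :: 'b and j
  proof -
    have "Poly_Mapping.single j (a j) + (m - Poly_Mapping.single j (a j)) = m"
      using that by (intro poly_mapping_eqI) (auto simp: lookup_add lookup_minus lookup_single when_def)
    then have "Poly_Mapping.single m k = (\<Sum>i\<in>UNIV. Var i ^ a i * (if i = j then Poly_Mapping.single (m - Poly_Mapping.single j (a j)) k else 0))"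
      by (simp add: Var_power mult_single if_distrib[of "(*) _"] cong: if_cong)
    then show ?thesis by (intro exI)
  qed
  then have "\<forall>m\<in>Poly_Mapping.keys p. \<exists>q. Poly_Mapping.single m (Poly_Mapping.lookup p m) = (\<Sum>i\<in>UNIV. Var i ^ a i * q i)"
    using assms unfolding monomial_ideal_def by blast
  from bchoice[OF this] obtain q where q: "\<And>m. m \<in> Poly_Mapping.keys p \<Longrightarrow>
      Poly_Mapping.single m (Poly_Mapping.lookup p m) = (\<Sum>i\<in>UNIV. Var i ^ a i * q m i)"
    by blast
  have "p = (\<Sum>m\<in>Poly_Mapping.keys p. \<Sum>i\<in>UNIV. Var i ^ a i * q m i)"
    using poly_eq_sum_monomials[of p] q by simp
  also have "\<dots> = (\<Sum>i\<in>UNIV. Var i ^ a i * (\<Sum>m\<in>Poly_Mapping.keys p. q m i))"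
    by (subst sum.swap) (simp add: sum_distrib_left)
  finally show ?thesis by (rule that)
qed

text \<open>The sum of the numbers \<open>a i - 1\<close> is the socle degree of the quotient; a monomial of larger degree
  must exceed \<open>a i - 1\<close> for some \<open>i\<close>.\<close>

lemma hom_in_monomial_ideal:
  assumes "p \<in> homogeneous_part t" and "(\<Sum>i\<in>UNIV. int (a i) - 1) < t"
  shows "p \<in> monomial_ideal a"
  unfolding monomial_ideal_def
proof (intro CollectI ballI)
  fix m assume "m \<in> Poly_Mapping.keys p"
  then have "int (total_deg m) = t" using assms(1) by (simp add: homogeneous_part_def)
  then have deg: "(\<Sum>i\<in>UNIV. int (a i) - 1) < (\<Sum>i\<in>UNIV. int (Poly_Mapping.lookup m i))"
    using assms(2) by (simp add: total_deg_def)
  show "\<exists>i. a i \<le> Poly_Mapping.lookup m i"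
  proof (rule ccontr)
    assume "\<not> ?thesis"
    then have "(\<Sum>i\<in>UNIV. int (Poly_Mapping.lookup m i)) \<le> (\<Sum>i\<in>UNIV. int (a i) - 1)"
      by (intro sum_mono) (metis int_one_le_iff_zero_less le_diff_eq not_le of_nat_less_iff zless_imp_add1_zle)
    with deg show False by simp
  qed
qed

text \<open>Together with multiplication by the linear form \<open>lform b\<close>, this operator spans a copy of
  \<open>sl\<^sub>2\<close>. On the monomials in a single variable it sends \<open>x ^ m\<close> to a multiple of
  \<open>m * (a - m) * x ^ (m - 1)\<close>; the factor \<open>a - m\<close> makes it act on the quotient by \<open>x ^ a\<close>.\<close>

definition lowering ::
    "('n::finite \<Rightarrow> 'k) \<Rightarrow> ('n \<Rightarrow> nat) \<Rightarrow> ('n, 'k::field_char_0) mpolynomial \<Rightarrow> ('n, 'k) mpolynomial" where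
  "lowering b a p = (\<Sum>i\<in>UNIV. const (inverse (b i)) *
     (const (of_nat (a i) - 1) * pd i p - Var i * pd i (pd i p)))"

lemma lowering_add: "lowering b a (p + q) = lowering b a p + lowering b a q"
  by (simp add: lowering_def pd_add algebra_simps flip: sum.distrib)

lemma lowering_single:
  "lowering b a (Poly_Mapping.single m k) = (\<Sum>i\<in>UNIV. Poly_Mapping.single (m - Poly_Mapping.single i 1)
     (inverse (b i) * of_nat (Poly_Mapping.lookup m i) * (of_nat (a i) - of_nat (Poly_Mapping.lookup m i)) * k))"
proof -
  have "const (of_nat (a i) - 1) * pd i (Poly_Mapping.single m k) - Var i * pd i (pd i (Poly_Mapping.single m k))
      = Poly_Mapping.single (m - Poly_Mapping.single i 1)
         (of_nat (Poly_Mapping.lookup m i) * (of_nat (a i) - of_nat (Poly_Mapping.lookup m i)) * k)" for i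
  proof (cases "Poly_Mapping.lookup m i < 2")
    case True
    then have "Poly_Mapping.lookup m i = 0 \<or> Poly_Mapping.lookup m i = 1" by linarith
    then show ?thesis by (auto simp: pd_single lookup_minus mult_single single_diff[symmetric] algebra_simps simp del: single_of_nat)
  next
    case False
    then have m: "Poly_Mapping.single i 1 + (m - Poly_Mapping.single i 1 - Poly_Mapping.single i 1) = m - Poly_Mapping.single i 1"
      by (intro poly_mapping_eqI) (auto simp: lookup_add lookup_minus lookup_single when_def)
    show ?thesis using False
      by (simp add: pd_single lookup_minus mult_single Var_def m[simplified] single_diff[symmetric] of_nat_diff)
        (simp add: algebra_simps)
  qed
  then show ?thesis by (simp add: lowering_def mult_single mult.assoc)
qed

lemma lowering_monomial_ideal:
  assumes "p \<in> monomial_ideal a"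
  shows "lowering b a p \<in> monomial_ideal a"
proof -
  have "lowering b a (Poly_Mapping.single m k) \<in> monomial_ideal a"
    if j: "a j \<le> Poly_Mapping.lookup m j" for m k j
    unfolding lowering_single
  proof (intro monomial_ideal_sum)
    fix i
    show "Poly_Mapping.single (m - Poly_Mapping.single i 1)
       (inverse (b i) * of_nat (Poly_Mapping.lookup m i) * (of_nat (a i) - of_nat (Poly_Mapping.lookup m i)) * k)
       \<in> monomial_ideal a"
    proof (cases "i = j \<and> a j = Poly_Mapping.lookup m j")
      case False
      with j show ?thesis
        by (intro single_in_monomial_ideal[of _ j]) (auto simp: lookup_minus lookup_single when_def)
    qed simp
  qed
  then have "\<forall>m\<in>Poly_Mapping.keys p. lowering b a (Poly_Mapping.single m (Poly_Mapping.lookup p m)) \<in> monomial_ideal a"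
    using assms unfolding monomial_ideal_def by blast
  moreover have "lowering b a p = (\<Sum>m\<in>Poly_Mapping.keys p. lowering b a (Poly_Mapping.single m (Poly_Mapping.lookup p m)))"
  proof -
    have 0: "lowering b a 0 = 0"
      using lowering_add[of b a 0 0] by simp
    have "lowering b a (\<Sum>m\<in>A. f m) = (\<Sum>m\<in>A. lowering b a (f m))" for A and f :: "_ \<Rightarrow> ('a, 'b) mpolynomial"
      by (induction A rule: infinite_finite_induct) (simp_all add: 0 lowering_add)
    then show ?thesis using poly_eq_sum_monomials[of p] by metis
  qed
  ultimately show ?thesis by (simp add: monomial_ideal_sum)
qed

lemma hom_lowering: "p \<in> homogeneous_part t \<Longrightarrow> lowering b a p \<in> homogeneous_part (t - 1)"
  using hom_mult[OF hom_Var hom_pd[OF hom_pd, of p t]] unfolding lowering_def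
  by (intro hom_sum hom_const_mult hom_diff hom_pd) simp_all

text \<open>The commutation relation of \<open>sl\<^sub>2\<close>: by the Leibniz rule and Euler's identity, the commutator of lowering
  and multiplication by the linear form is a scalar in each degree.\<close>

lemma lowering_lform:
  fixes b :: "'n::finite \<Rightarrow> 'k::field_char_0"
  assumes b: "\<And>i. b i \<noteq> 0" and p: "p \<in> homogeneous_part t"
  shows "lowering b a (lform b * p)
    = lform b * lowering b a p + const (of_int ((\<Sum>i\<in>UNIV. int (a i) - 1) - 2 * t)) * p"
proof -
  have one: "const (inverse (b i)) * const (b i) = 1" for i
    using b[of i] by (simp add: mult_single)
  have summand: "const (inverse (b i)) * (const (of_nat (a i) - 1) * pd i (lform b * p) - Var i * pd i (pd i (lform b * p)))
    = lform b * (const (inverse (b i)) * (const (of_nat (a i) - 1) * pd i p - Var i * pd i (pd i p)))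
      + (const (of_nat (a i) - 1) * p - 2 * (Var i * pd i p))" for i
  proof -
    have "const (inverse (b i)) * (const (of_nat (a i) - 1) * pd i (lform b * p) - Var i * pd i (pd i (lform b * p)))
      = lform b * (const (inverse (b i)) * (const (of_nat (a i) - 1) * pd i p - Var i * pd i (pd i p)))
        + (const (inverse (b i)) * const (b i)) * (const (of_nat (a i) - 1) * p - 2 * (Var i * pd i p))"
      by (simp add: pd_mult pd_add pd_lform algebra_simps del: single_of_nat)
    then show ?thesis by (simp add: one)
  qed
  have "lowering b a (lform b * p) = lform b * lowering b a p
      + (\<Sum>i\<in>UNIV. const (of_nat (a i) - 1) * p) - 2 * (\<Sum>i\<in>UNIV. Var i * pd i p)"
    unfolding lowering_def summand by (simp add: sum.distrib sum_subtractf sum_distrib_left)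
  also have "(\<Sum>i\<in>UNIV. const (of_nat (a i) - 1) * p) = const (of_int (\<Sum>i\<in>UNIV. int (a i) - 1)) * p"
    by (simp add: const_sum sum_distrib_right del: single_of_int)
  also have "(2::('n, 'k) mpolynomial) = const (of_int 2)" by simp
  finally show ?thesis
    unfolding euler_identity[OF p]
    by (simp add: const_diff const_mult algebra_simps del: single_of_int of_int_numeral)
qed

lemma lowering_lform_power:
  fixes b :: "'n::finite \<Rightarrow> 'k::field_char_0"
  assumes b: "\<And>i. b i \<noteq> 0" and p: "p \<in> homogeneous_part t"
  shows "lowering b a (lform b ^ Suc q * p) = lform b ^ Suc q * lowering b a p
    + const (of_int (int (Suc q) * ((\<Sum>i\<in>UNIV. int (a i) - 1) - 2 * t - int q))) * (lform b ^ q * p)"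
proof (induction q)
  case 0
  show ?case using lowering_lform[where b = b and a = a, OF assms] by (simp del: single_of_int)
next
  case (Suc q)
  define s where "s = (\<Sum>i\<in>UNIV. int (a i) - 1)"
  have "lform b ^ Suc q * p \<in> homogeneous_part (int (Suc q) + t)"
    using hom_mult[OF hom_power[OF hom_lform] p, of b "Suc q"] by simp
  from lowering_lform[where b = b and a = a, OF b this]
  have "lowering b a (lform b ^ Suc (Suc q) * p) = lform b * lowering b a (lform b ^ Suc q * p)
      + const (of_int (s - 2 * (int (Suc q) + t))) * (lform b ^ Suc q * p)"
    by (simp add: mult.assoc s_def)
  also have "\<dots> = lform b ^ Suc (Suc q) * lowering b a p +
      (const (of_int (int (Suc q) * (s - 2 * t - int q))) + const (of_int (s - 2 * (int (Suc q) + t)))) * (lform b ^ Suc q * p)"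
    unfolding Suc s_def by (simp add: algebra_simps del: single_of_int of_nat_Suc)
  also have "const (of_int (int (Suc q) * (s - 2 * t - int q))) + const (of_int (s - 2 * (int (Suc q) + t)))
      = (const (of_int (int (Suc (Suc q)) * (s - 2 * t - int (Suc q)))) :: ('n, 'k) mpolynomial)"
    unfolding const_add[symmetric] of_int_add[symmetric] by (simp add: algebra_simps del: single_of_int)
  finally show ?case by (simp only: s_def)
qed

text \<open>Suppose \<open>l ^ (q + 1) * p\<close> lies in the ideal \<open>J\<close>. Lowering it and commuting shows that \<open>l ^ q * w\<close>
  lies in \<open>J\<close> for \<open>w = l * lowering p + c * p\<close>, where the degree bound makes the scalar \<open>c\<close> nonzero.
  Induction on \<open>q\<close> gives \<open>w \<in> J\<close>, hence \<open>l ^ (q + 2) * lowering p \<in> J\<close>, and induction on the degree gives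
  \<open>lowering p \<in> J\<close>. Then \<open>c * p \<in> J\<close>.\<close>

lemma strong_lefschetz_inj:
  fixes b :: "'n::finite \<Rightarrow> 'k::field_char_0"
  assumes b: "\<And>i. b i \<noteq> 0"
    and p: "p \<in> homogeneous_part t" "lform b ^ q * p \<in> monomial_ideal a"
    and deg: "2 * t + int q \<le> (\<Sum>i\<in>UNIV. int (a i) - 1)"
  shows "p \<in> monomial_ideal a"
proof (cases "t < 0")
  case True
  then show ?thesis using hom_neg[OF p(1)] by simp
next
  case False
  then show ?thesis using p deg
  proof (induction "nat t" arbitrary: t p q)
    case 0
    have t: "t = 0" using 0 by simp
    show ?case using 0(3-)
    proof (induction q)
      case (Suc q)
      define s where "s = (\<Sum>i\<in>UNIV. int (a i) - 1)"
      define c where "c = (of_int (int (Suc q) * (s - 2 * t - int q)) :: 'k)"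
      have c: "c \<noteq> 0" unfolding c_def s_def using Suc.prems(3) by (simp del: of_nat_Suc of_int_mult)
      have "lowering b a p = 0" using hom_neg[OF hom_lowering[OF Suc.prems(1)]] t by simp
      then have "const c * (lform b ^ q * p) = lowering b a (lform b ^ Suc q * p)"
        using lowering_lform_power[where b = b and a = a and q = q, OF b Suc.prems(1)] by (simp add: c_def s_def)
      then have "lform b ^ q * p \<in> monomial_ideal a"
        using lowering_monomial_ideal[OF Suc.prems(2), of b] monomial_ideal_const_mult_iff[OF c] by metis
      then show ?case using Suc by simp
    qed simp
  next
    case (Suc n)
    note outer = Suc.hyps
    show ?case using Suc.prems(2-)
    proof (induction q arbitrary: p)
      case (Suc q)
      define s where "s = (\<Sum>i\<in>UNIV. int (a i) - 1)"
      define c where "c = (of_int (int (Suc q) * (s - 2 * t - int q)) :: 'k)"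
      have c: "c \<noteq> 0" unfolding c_def s_def using Suc.prems(3) by (simp del: of_nat_Suc of_int_mult)
      define w where "w = lform b * lowering b a p + const c * p"
      have "lform b ^ q * w = lowering b a (lform b ^ Suc q * p)"
        using lowering_lform_power[where b = b and a = a and q = q, OF b Suc.prems(1)]
        by (simp add: c_def s_def w_def algebra_simps del: single_of_int)
      then have "lform b ^ q * w \<in> monomial_ideal a"
        using lowering_monomial_ideal[OF Suc.prems(2), of b] by simp
      moreover have low: "lowering b a p \<in> homogeneous_part (t - 1)" by (rule hom_lowering[OF Suc.prems(1)])
      then have "w \<in> homogeneous_part t"
        using hom_mult[OF hom_lform low] Suc.prems(1) unfolding w_def by (intro hom_add hom_const_mult) auto
      ultimately have w: "w \<in> monomial_ideal a" using Suc by simp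
      have "lform b ^ (q + 2) * lowering b a p = lform b ^ Suc q * w - const c * (lform b ^ Suc q * p)"
        by (simp add: w_def algebra_simps)
      also have "\<dots> \<in> monomial_ideal a"
        by (intro monomial_ideal_diff monomial_ideal_mult w Suc.prems)
      finally have "lowering b a p \<in> monomial_ideal a"
        using outer(2) Suc.prems by (intro outer(1)[OF _ _ low, of "q + 2"]) auto
      then have "w - lform b * lowering b a p \<in> monomial_ideal a"
        by (intro monomial_ideal_diff monomial_ideal_mult w)
      then have "const c * p \<in> monomial_ideal a" by (simp add: w_def)
      then show ?case by (simp only: monomial_ideal_const_mult_iff[OF c])
    qed simp
  qed
qed

text \<open>Some power of \<open>l\<close> sends \<open>u\<close> into the ideal for degree reasons. As before, lowering allows one
  to reduce this exponent at the price of replacing \<open>u\<close> by \<open>l * lowering u + c * u\<close>, which differs from a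
  nonzero multiple of \<open>u\<close> by a multiple of \<open>l\<close>.\<close>

lemma strong_lefschetz_surj:
  fixes b :: "'n::finite \<Rightarrow> 'k::field_char_0"
  assumes b: "\<And>i. b i \<noteq> 0"
    and u: "u \<in> homogeneous_part t"
    and deg: "(\<Sum>i\<in>UNIV. int (a i) - 1) < 2 * t"
  shows "\<exists>v\<in>homogeneous_part (t - 1). u - lform b * v \<in> monomial_ideal a"
proof -
  define s where "s = (\<Sum>i\<in>UNIV. int (a i) - 1)"
  have "\<exists>v\<in>homogeneous_part (t - 1). u - lform b * v \<in> monomial_ideal a"
    if "u \<in> homogeneous_part t" "lform b ^ q * u \<in> monomial_ideal a" for q u
    using that
  proof (induction q arbitrary: u)
    case 0
    then show ?case by (intro bexI[of _ 0]) auto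
  next
    case (Suc q)
    define c where "c = (of_int (int (Suc q) * (s - 2 * t - int q)) :: 'k)"
    have "s - 2 * t - int q \<noteq> 0" using deg by (simp add: s_def)
    then have c: "c \<noteq> 0" unfolding c_def by (simp del: of_nat_Suc of_int_mult)
    define w where "w = lform b * lowering b a u + const c * u"
    have low: "lowering b a u \<in> homogeneous_part (t - 1)" by (rule hom_lowering[OF Suc.prems(1)])
    have wt: "w \<in> homogeneous_part t"
      using hom_mult[OF hom_lform low] Suc.prems(1) unfolding w_def by (intro hom_add hom_const_mult) auto
    have "lform b ^ q * w = lowering b a (lform b ^ Suc q * u)"
      using lowering_lform_power[where b = b and a = a and q = q, OF b Suc.prems(1)]
      by (simp add: c_def s_def w_def algebra_simps del: single_of_int)
    then have "lform b ^ q * w \<in> monomial_ideal a"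
      using lowering_monomial_ideal[OF Suc.prems(2), of b] by simp
    from Suc.IH[OF wt this] obtain v where v: "v \<in> homogeneous_part (t - 1)" "w - lform b * v \<in> monomial_ideal a"
      by blast
    define v' where "v' = const (inverse c) * (v - lowering b a u)"
    have "const c * (u - lform b * v') = w - lform b * v"
    proof -
      have "const c * const (inverse c) = (1 :: ('n, 'k) mpolynomial)" using c by (simp add: mult_single)
      then have "const c * v' = v - lowering b a u"
        unfolding v'_def mult.assoc[symmetric] by (simp only: mult_1)
      then have "const c * (lform b * v') = lform b * (v - lowering b a u)"
        by (simp add: mult.left_commute)
      then show ?thesis
        by (simp add: w_def algebra_simps)
    qed
    then have "u - lform b * v' \<in> monomial_ideal a"
      using v(2) monomial_ideal_const_mult_iff[OF c] by metis
    moreover have "v' \<in> homogeneous_part (t - 1)"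
      unfolding v'_def by (intro hom_const_mult hom_diff v low)
    ultimately show ?case by blast
  qed
  moreover have "lform b ^ nat (s - t + 1) * u \<in> monomial_ideal a"
    by (rule hom_in_monomial_ideal[OF hom_mult[OF hom_power[OF hom_lform] u]]) (simp add: s_def)
  ultimately show ?thesis using u by blast
qed

section \<open>Ranks of orthogonal families\<close>

lemma underdetermined_system:
  fixes A :: "'j \<Rightarrow> 'i \<Rightarrow> 'k::field"
  assumes "finite J" "finite I" "card J < card I"
  shows "\<exists>x. (\<exists>i\<in>I. x i \<noteq> 0) \<and> (\<forall>j\<in>J. (\<Sum>i\<in>I. A j i * x i) = 0)"
  using assms
proof (induction J arbitrary: I A rule: finite_induct)
  case empty
  then have "I \<noteq> {}" by auto
  then show ?case by (intro exI[of _ "\<lambda>_. 1"]) auto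
next
  case (insert j J)
  show ?case
  proof (cases "\<forall>i\<in>I. A j i = 0")
    case True
    have "card J < card I" using insert by simp
    from insert.IH[OF insert.prems(1) this, of A] True show ?thesis by auto
  next
    case False
    then obtain i0 where i0: "i0 \<in> I" "A j i0 \<noteq> 0" by blast
    define I' where "I' = I - {i0}"
    have I': "finite I'" "i0 \<notin> I'" "I = insert i0 I'" "card J < card I'"
      using insert i0 by (auto simp: I'_def)
    \<comment> \<open>Gaussian elimination: the pivot \<open>A j i0\<close> clears the column of \<open>i0\<close>.\<close>
    define A' where "A' j' i = A j' i - A j' i0 * A j i / A j i0" for j' i
    from insert.IH[OF I'(1,4), of A'] obtain x where
      x: "\<exists>i\<in>I'. x i \<noteq> 0" "\<forall>j'\<in>J. (\<Sum>i\<in>I'. A' j' i * x i) = 0" by blast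
    define s where "s = (\<Sum>i\<in>I'. A j i * x i)"
    define x' where "x' = x(i0 := - s / A j i0)"
    have sum: "(\<Sum>i\<in>I. A j' i * x' i) = (\<Sum>i\<in>I'. A j' i * x i) - A j' i0 * s / A j i0" for j'
    proof -
      have "(\<Sum>i\<in>I'. A j' i * x' i) = (\<Sum>i\<in>I'. A j' i * x i)"
        using I'(2) by (intro sum.cong refl) (auto simp: x'_def)
      then show ?thesis using I' by (simp add: x'_def)
    qed
    have "(\<Sum>i\<in>I. A j' i * x' i) = 0" if "j' \<in> J" for j'
    proof -
      have "(\<Sum>i\<in>I'. A' j' i * x i) = (\<Sum>i\<in>I'. A j' i * x i) - A j' i0 * s / A j i0"
        by (simp add: A'_def s_def left_diff_distrib sum_subtractf sum_distrib_left sum_divide_distrib mult.assoc)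
      with x(2) that show ?thesis by (simp add: sum)
    qed
    moreover have "(\<Sum>i\<in>I. A j i * x' i) = 0"
      using i0 by (simp add: sum s_def[symmetric])
    moreover have "\<exists>i\<in>I. x' i \<noteq> 0"
      using x(1) I' by (auto simp: x'_def)
    ultimately show ?thesis by blast
  qed
qed

text \<open>The image of \<open>T\<close> is orthogonal to that of the restriction of \<open>S\<close> to the kernel of \<open>C\<close>. If \<open>T\<close>
  were injective, these spaces would have dimensions \<open>card X\<close> and at least \<open>card Z - card E\<close> inside
  a space of dimension \<open>card Y\<close>. Instead of dimensions, the proof uses a maximal set \<open>Y0\<close> of
  independent rows of \<open>T\<close>: a vector supported on \<open>Y0\<close> and orthogonal to the image of \<open>T\<close> vanishes.\<close>

lemma kernel_nontrivial_if_orthogonal: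
  fixes T :: "'y \<Rightarrow> 'x \<Rightarrow> 'k::field" and S :: "'y \<Rightarrow> 'z \<Rightarrow> 'k" and C :: "'e \<Rightarrow> 'z \<Rightarrow> 'k"
  assumes fin: "finite X" "finite Y" "finite Z" "finite E"
    and S_inj: "\<And>v. \<forall>e\<in>E. (\<Sum>z\<in>Z. C e z * v z) = 0 \<Longrightarrow> \<forall>y\<in>Y. (\<Sum>z\<in>Z. S y z * v z) = 0 \<Longrightarrow> \<forall>z\<in>Z. v z = 0"
    and orth: "\<And>v x. \<forall>e\<in>E. (\<Sum>z\<in>Z. C e z * v z) = 0 \<Longrightarrow> x \<in> X \<Longrightarrow>
        (\<Sum>y\<in>Y. (\<Sum>z\<in>Z. S y z * v z) * T y x) = 0"
    and card: "card Y + card E < card X + card Z"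
  shows "\<exists>w. (\<exists>x\<in>X. w x \<noteq> 0) \<and> (\<forall>y\<in>Y. (\<Sum>x\<in>X. T y x * w x) = 0)"
proof (rule ccontr)
  assume noker: "\<not> ?thesis"
  define indep where "indep Y0 \<longleftrightarrow> Y0 \<subseteq> Y \<and>
    (\<forall>w. (\<forall>x\<in>X. (\<Sum>y\<in>Y0. w y * T y x) = 0) \<longrightarrow> (\<forall>y\<in>Y0. w y = 0))" for Y0
  have "indep {}" by (simp add: indep_def)
  moreover have "\<forall>Y0. indep Y0 \<longrightarrow> card Y0 < Suc (card Y)"
    using fin by (auto simp: indep_def less_Suc_eq_le intro: card_mono)
  ultimately obtain Y0 where Y0: "indep Y0" "\<And>Y1. indep Y1 \<Longrightarrow> card Y1 \<le> card Y0"
    using ex_has_greatest_nat[of indep "{}" card "Suc (card Y)"] by (metis less_imp_le)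
  have Y0_sub: "Y0 \<subseteq> Y" and finY0: "finite Y0"
    using Y0(1) fin by (auto simp: indep_def finite_subset)
  have "card X \<le> card Y0"
  proof (rule ccontr)
    assume "\<not> card X \<le> card Y0"
    then obtain v where v: "\<exists>x\<in>X. v x \<noteq> 0" "\<forall>y\<in>Y0. (\<Sum>x\<in>X. T y x * v x) = 0"
      using underdetermined_system[of Y0 X T] finY0 fin by auto
    have "(\<Sum>x\<in>X. T y x * v x) = 0" if y: "y \<in> Y" for y
    proof (cases "y \<in> Y0")
      case False
      have "\<not> indep (insert y Y0)"
        using Y0(2)[of "insert y Y0"] False finY0 by auto
      then obtain w where w: "\<forall>x\<in>X. (\<Sum>y'\<in>insert y Y0. w y' * T y' x) = 0"
        "\<exists>y'\<in>insert y Y0. w y' \<noteq> 0"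
        using y Y0_sub by (auto simp: indep_def)
      have rel: "w y * T y x + (\<Sum>y'\<in>Y0. w y' * T y' x) = 0" if "x \<in> X" for x
        using w(1) that False finY0 by simp
      have "w y \<noteq> 0"
      proof
        assume "w y = 0"
        then have "\<forall>y'\<in>Y0. w y' = 0" using rel Y0(1) by (simp add: indep_def)
        with w(2) \<open>w y = 0\<close> show False by auto
      qed
      have "w y * (\<Sum>x\<in>X. T y x * v x) = (\<Sum>x\<in>X. (w y * T y x) * v x)"
        by (simp add: sum_distrib_left mult.assoc)
      also have "\<dots> = (\<Sum>x\<in>X. - (\<Sum>y'\<in>Y0. w y' * T y' x) * v x)"
        using rel by (intro sum.cong refl arg_cong2[where f = "(*)"]) (simp add: eq_neg_iff_add_eq_0)
      also have "\<dots> = - (\<Sum>y'\<in>Y0. w y' * (\<Sum>x\<in>X. T y' x * v x))"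
        by (simp add: sum_distrib_left sum_distrib_right sum_negf mult.assoc) (rule sum.swap)
      also have "\<dots> = 0" using v(2) by simp
      finally show ?thesis using \<open>w y \<noteq> 0\<close> by simp
    qed (use v in blast)
    with v(1) noker show False by blast
  qed
  \<comment> \<open>More unknowns than equations: some element of the kernel of \<open>C\<close> has an image under \<open>S\<close> that is
    supported on \<open>Y0\<close>.\<close>
  define J where "J = E <+> (Y - Y0)"
  define A where "A j z = (case j of Inl e \<Rightarrow> C e z | Inr y \<Rightarrow> S y z)" for j z
  have "card J = card E + (card Y - card Y0)"
    using fin finY0 Y0_sub by (simp add: J_def card_Plus card_Diff_subset)
  moreover have "card Y0 \<le> card Y" using fin Y0_sub by (rule_tac card_mono)
  ultimately have "card J < card Z" using \<open>card X \<le> card Y0\<close> card by linarith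
  moreover have "finite J" using fin by (simp add: J_def)
  ultimately obtain v where v: "\<exists>z\<in>Z. v z \<noteq> 0" "\<forall>j\<in>J. (\<Sum>z\<in>Z. A j z * v z) = 0"
    using underdetermined_system[of J Z A] fin by blast
  have C: "\<forall>e\<in>E. (\<Sum>z\<in>Z. C e z * v z) = 0"
  proof
    fix e assume "e \<in> E"
    then have "Inl e \<in> J" unfolding J_def by (rule InlI)
    with v(2) show "(\<Sum>z\<in>Z. C e z * v z) = 0" by (force simp: A_def)
  qed
  have off: "(\<Sum>z\<in>Z. S y z * v z) = 0" if "y \<in> Y - Y0" for y
    using v(2) that by (force simp: J_def A_def)
  have "(\<Sum>y\<in>Y0. (\<Sum>z\<in>Z. S y z * v z) * T y x) = 0" if "x \<in> X" for x
  proof -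
    have "(\<Sum>y\<in>Y0. (\<Sum>z\<in>Z. S y z * v z) * T y x) = (\<Sum>y\<in>Y. (\<Sum>z\<in>Z. S y z * v z) * T y x)"
      by (rule sum.mono_neutral_left) (use fin Y0_sub off in auto)
    with orth[OF C that] show ?thesis by simp
  qed
  then have "\<forall>y\<in>Y0. (\<Sum>z\<in>Z. S y z * v z) = 0"
    using Y0(1)[unfolded indep_def, THEN conjunct2, rule_format, of "\<lambda>y. \<Sum>z\<in>Z. S y z * v z"] by simp
  with off have "\<forall>y\<in>Y. (\<Sum>z\<in>Z. S y z * v z) = 0" by blast
  from S_inj[OF C this] v(1) show False by blast
qed

section \<open>Counting monomials\<close>

definition box :: "('n::finite \<Rightarrow> nat) \<Rightarrow> int \<Rightarrow> ('n \<Rightarrow>\<^sub>0 nat) set" where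
  "box a t = {m. (\<forall>i. Poly_Mapping.lookup m i < a i) \<and> int (total_deg m) = t}"

lemma distinct_4: "distinct [1, 2, 3, 4 :: 4]"
  by (rule card_distinct) (use UNIV_4(2) in simp)

lemma neq_4 [simp]:
  "(1::4) \<noteq> 2" "(1::4) \<noteq> 3" "(1::4) \<noteq> 4" "(2::4) \<noteq> 3" "(2::4) \<noteq> 4" "(3::4) \<noteq> 4"
  "(2::4) \<noteq> 1" "(3::4) \<noteq> 1" "(4::4) \<noteq> 1" "(3::4) \<noteq> 2" "(4::4) \<noteq> 2" "(4::4) \<noteq> 3"
  using distinct_4 by (simp_all only: distinct.simps list.set) (auto simp only: insert_iff empty_iff)

lemma all_4: "(\<forall>i::4. P i) \<longleftrightarrow> P 1 \<and> P 2 \<and> P 3 \<and> P 4"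
proof -
  have "(\<forall>i::4. P i) \<longleftrightarrow> (\<forall>i\<in>{1, 2, 3, 4}. P i)" by (simp only: UNIV_4(1)[symmetric] ball_UNIV)
  then show ?thesis by simp
qed

lemma sum_4: "(\<Sum>i\<in>UNIV. f i) = f 1 + f 2 + f 3 + f (4::4)" for f :: "4 \<Rightarrow> 'a::comm_monoid_add"
proof -
  have "(\<Sum>i\<in>UNIV. f i) = sum f {1, 2, 3, 4}" by (simp only: UNIV_4(1))
  also have "\<dots> = f 1 + (f 2 + (f 3 + f 4))" by simp
  finally show ?thesis by (simp add: add.assoc)
qed

lemma prod_4: "(\<Prod>i\<in>UNIV. f i) = f 1 * f 2 * f 3 * f (4::4)" for f :: "4 \<Rightarrow> 'a::comm_monoid_mult"
proof -
  have "(\<Prod>i\<in>UNIV. f i) = prod f {1, 2, 3, 4}" by (simp only: UNIV_4(1))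
  also have "\<dots> = f 1 * (f 2 * (f 3 * f 4))" by simp
  finally show ?thesis by (simp add: mult.assoc)
qed

definition vec4 :: "'a \<Rightarrow> 'a \<Rightarrow> 'a \<Rightarrow> 'a \<Rightarrow> 4 \<Rightarrow> 'a" where
  "vec4 a1 a2 a3 a4 i = (if i = 1 then a1 else if i = 2 then a2 else if i = 3 then a3 else a4)"

lemma vec4_simps [simp]:
  "vec4 a1 a2 a3 a4 1 = a1" "vec4 a1 a2 a3 a4 2 = a2" "vec4 a1 a2 a3 a4 3 = a3" "vec4 a1 a2 a3 a4 4 = a4"
  unfolding vec4_def by (simp_all only: neq_4 if_False if_True simp_thms)

definition exponent4 :: "nat \<Rightarrow> nat \<Rightarrow> nat \<Rightarrow> nat \<Rightarrow> (4 \<Rightarrow>\<^sub>0 nat)" where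
  "exponent4 p q r s = Abs_poly_mapping (vec4 p q r s)"

lemma lookup_exponent4 [simp]: "Poly_Mapping.lookup (exponent4 p q r s) = vec4 p q r s"
  by (simp add: exponent4_def)

lemma exponent4_eqI: "\<lbrakk>Poly_Mapping.lookup m 1 = p; Poly_Mapping.lookup m 2 = q;
    Poly_Mapping.lookup m 3 = r; Poly_Mapping.lookup m 4 = s\<rbrakk> \<Longrightarrow> m = exponent4 p q r s"
proof (rule poly_mapping_eqI)
  fix i assume "Poly_Mapping.lookup m 1 = p" "Poly_Mapping.lookup m 2 = q"
    "Poly_Mapping.lookup m 3 = r" "Poly_Mapping.lookup m 4 = s"
  then have "\<forall>i. Poly_Mapping.lookup m i = vec4 p q r s i"
    unfolding all_4 by simp
  then show "Poly_Mapping.lookup m i = Poly_Mapping.lookup (exponent4 p q r s) i" by simp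
qed

text \<open>The number of pairs \<open>(p, q)\<close> with \<open>p < a\<close>, \<open>q < b\<close> and \<open>p + q = t\<close>.\<close>

definition trapezoid :: "nat \<Rightarrow> nat \<Rightarrow> int \<Rightarrow> int" where
  "trapezoid a b t = max 0 (min (min (t + 1) (int a)) (min (int b) (int a + int b - 1 - t)))"

lemma card_pairs: "int (card {p. p < a \<and> 0 \<le> t - int p \<and> t - int p < int b}) = trapezoid a b t"
proof -
  have "int ` {p. p < a \<and> 0 \<le> t - int p \<and> t - int p < int b} = {max 0 (t - int b + 1)..min t (int a - 1)}"
  proof (intro subset_antisym subsetI)
    fix x assume x: "x \<in> {max 0 (t - int b + 1)..min t (int a - 1)}"
    then have "x = int (nat x)" "nat x \<in> {p. p < a \<and> 0 \<le> t - int p \<and> t - int p < int b}" by auto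
    then show "x \<in> int ` {p. p < a \<and> 0 \<le> t - int p \<and> t - int p < int b}" by (rule image_eqI)
  qed auto
  then have "card {p. p < a \<and> 0 \<le> t - int p \<and> t - int p < int b} = card {max 0 (t - int b + 1)..min t (int a - 1)}"
    using card_image[of int "{p. p < a \<and> 0 \<le> t - int p \<and> t - int p < int b}"] inj_on_of_nat by metis
  then show ?thesis by (simp add: trapezoid_def min_def max_def)
qed

lemma card_box:
  "int (card (box (vec4 a1 a2 a3 a4) t)) = (\<Sum>u<a2. \<Sum>w<a3. trapezoid a1 a4 (t - int u - int w))"
proof -
  define P where "P u w = {p. p < a1 \<and> 0 \<le> t - int u - int w - int p \<and> t - int u - int w - int p < int a4}" for u w
  define K where "K = (SIGMA u:{..<a2}. SIGMA w:{..<a3}. P u w)"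
  define g where "g = (\<lambda>m::4 \<Rightarrow>\<^sub>0 nat. (Poly_Mapping.lookup m 2, Poly_Mapping.lookup m 3, Poly_Mapping.lookup m 1))"
  have deg: "total_deg m = Poly_Mapping.lookup m 1 + Poly_Mapping.lookup m 2 + Poly_Mapping.lookup m 3 + Poly_Mapping.lookup m 4"
    for m :: "4 \<Rightarrow>\<^sub>0 nat"
    by (simp only: total_deg_def sum_4)
  have "inj_on g (box (vec4 a1 a2 a3 a4) t)"
  proof (rule inj_onI)
    fix m n assume m: "m \<in> box (vec4 a1 a2 a3 a4) t" and n: "n \<in> box (vec4 a1 a2 a3 a4) t" and g: "g m = g n"
    have "int (total_deg m) = int (total_deg n)" using m n by (simp add: box_def)
    then have "Poly_Mapping.lookup m 4 = Poly_Mapping.lookup n 4" using g unfolding deg g_def by simp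
    with g have "m = exponent4 (Poly_Mapping.lookup n 1) (Poly_Mapping.lookup n 2) (Poly_Mapping.lookup n 3) (Poly_Mapping.lookup n 4)"
      unfolding g_def by (intro exponent4_eqI) simp_all
    also have "\<dots> = n" by (rule exponent4_eqI[symmetric]) simp_all
    finally show "m = n" .
  qed
  moreover have "g ` box (vec4 a1 a2 a3 a4) t = K"
  proof (intro subset_antisym subsetI)
    fix x assume "x \<in> g ` box (vec4 a1 a2 a3 a4) t"
    then show "x \<in> K"
      unfolding K_def P_def box_def all_4 g_def deg by auto
  next
    fix x assume "x \<in> K"
    then obtain u w p where x: "x = (u, w, p)" "u < a2" "w < a3" "p \<in> P u w"
      unfolding K_def by auto
    define m where "m = exponent4 p u w (nat (t - int u - int w - int p))"
    have "m \<in> box (vec4 a1 a2 a3 a4) t"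
      using x unfolding box_def all_4 deg P_def m_def by (simp del: of_nat_add) auto
    moreover have "g m = x" by (simp add: g_def m_def x)
    ultimately show "x \<in> g ` box (vec4 a1 a2 a3 a4) t" by blast
  qed
  ultimately have "card (box (vec4 a1 a2 a3 a4) t) = card K"
    by (metis card_image)
  also have "\<dots> = (\<Sum>u<a2. \<Sum>w<a3. card (P u w))"
    unfolding K_def by (simp add: card_SigmaI P_def)
  finally show ?thesis
    by (simp only: P_def card_pairs of_nat_sum)
qed

text \<open>In the middle degree, symmetry of the trapezoid function turns the double sum into a
  telescoping one, so that the growth from one degree to the next only sees four values.\<close>

lemma card_box_growth_trapezoid:
  assumes t: "2 * t + 5 = int (a1 + a2 + a3 + a4)"
  shows "int (card (box (vec4 a1 a2 a3 a4) t)) - int (card (box (vec4 a1 a2 a3 a4) (t - 1)))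
    = trapezoid a1 a4 (t + 1 - int a3) + trapezoid a1 a4 (t + 2 - int a3)
      - trapezoid a1 a4 (t + 1) - trapezoid a1 a4 (t + 2)"
proof -
  define f where "f = trapezoid a1 a4"
  define C where "C t = (\<Sum>w<a3. f (t - int w))" for t
  have sym: "f x = f y" if "x + y = int a1 + int a4 - 2" for x y
    unfolding f_def trapezoid_def using that by (auto simp: min_def max_def)
  have M: "int (card (box (vec4 a1 a2 a3 a4) t)) = (\<Sum>u<a2. C (t - int u))" for t
    by (simp add: card_box C_def f_def)
  have "int (card (box (vec4 a1 a2 a3 a4) t)) - int (card (box (vec4 a1 a2 a3 a4) (t - 1)))
      = (\<Sum>u<a2. C (t - int u) - C (t - int (Suc u)))"
    unfolding M sum_subtractf[symmetric] by (simp add: algebra_simps)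
  also have "\<dots> = C t - C (t - int a2)"
    by (subst sum_lessThan_telescope') simp
  also have "C (t - int a2) = (\<Sum>w<a3. f (t - int a2 - int (a3 - Suc w)))"
    unfolding C_def by (rule sum.nat_diff_reindex[symmetric])
  also have "\<dots> = (\<Sum>w<a3. f (t + 2 - int w))"
    by (intro sum.cong refl sym) (use t in auto)
  also have "C t - (\<Sum>w<a3. f (t + 2 - int w))
      = (\<Sum>w<a3. (f (t + 1 - int (Suc w)) + f (t + 2 - int (Suc w))) - (f (t + 1 - int w) + f (t + 2 - int w)))"
    unfolding C_def sum_subtractf[symmetric] by (simp add: algebra_simps)
  also have "\<dots> = f (t + 1 - int a3) + f (t + 2 - int a3) - (f (t + 1) + f (t + 2))"
    by (subst sum_lessThan_telescope) simp
  finally show ?thesis by (simp add: f_def)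
qed

text \<open>With ordered bounds, the values at \<open>t + 1 - a3\<close> and \<open>t + 2 - a3\<close> lie on the plateau of the
  trapezoid of height \<open>a1\<close>, and those at \<open>t + 1\<close> and \<open>t + 2\<close> on its descending side or beyond it.\<close>

lemma card_box_growth:
  assumes t: "2 * t + 5 = int (a1 + a2 + a3 + a4)"
    and ord: "1 \<le> a1" "a1 \<le> a2" "a2 \<le> a3" "a3 \<le> a4" "a4 < a1 + a2 + a3"
  shows "int (card (box (vec4 a1 a2 a3 a4) t)) - int (card (box (vec4 a1 a2 a3 a4) (t - 1)))
    = (if a2 + a3 \<le> a1 + a4 then int (a1 + a2 + a3) - int a4 else 2 * int a1)"
proof -
  have mid: "trapezoid a1 a4 (t + 1 - int a3) = int a1" "trapezoid a1 a4 (t + 2 - int a3) = int a1"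
    unfolding trapezoid_def using t ord by (simp_all add: min_def max_def)
  have up: "trapezoid a1 a4 (t + 1) + trapezoid a1 a4 (t + 2) = max 0 (int a1 + int a4 - int a2 - int a3)"
    unfolding trapezoid_def using t ord by (simp add: min_def max_def)
  show ?thesis
    unfolding card_box_growth_trapezoid[OF t] mid using up t ord by (auto simp: max_def)
qed

lemma finite_box [simp]: "finite (box a t)"
proof (rule finite_imageD)
  show "inj_on Poly_Mapping.lookup (box a t)"
    unfolding inj_on_def poly_mapping_eq_iff by (intro ballI impI)
  have "Poly_Mapping.lookup ` box a t \<subseteq> {f. \<forall>i. f i \<in> {..<Suc (\<Sum>i\<in>UNIV. a i)}}"
  proof clarsimp
    fix m i assume "m \<in> box a t"
    then have "Poly_Mapping.lookup m i < a i" by (simp add: box_def)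
    also have "a i \<le> (\<Sum>i\<in>UNIV. a i)" by (rule member_le_sum) simp_all
    finally show "Poly_Mapping.lookup m i < Suc (sum a UNIV)" by simp
  qed
  moreover have "finite {f :: 'a \<Rightarrow> nat. \<forall>i. f i \<in> {..<Suc (\<Sum>i\<in>UNIV. a i)}}"
    using finite_set_of_finite_funs[of "UNIV :: 'a set" "{..<Suc (\<Sum>i\<in>UNIV. a i)}"] by simp
  ultimately show "finite (Poly_Mapping.lookup ` box a t)" by (rule finite_subset)
qed

text \<open>The monomials not involving the last variable form a basis modulo a linear form in which that
  variable occurs.\<close>

definition ternary :: "nat \<Rightarrow> (4 \<Rightarrow>\<^sub>0 nat) set" where
  "ternary r = (\<lambda>(p, q). exponent4 p q (r - p - q) 0) ` (SIGMA p:{..r}. {..r - p})"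

lemma finite_ternary [simp]: "finite (ternary r)"
  by (simp add: ternary_def)

lemma card_ternary: "2 * card (ternary r) = (r + 1) * (r + 2)"
proof -
  have "inj_on (\<lambda>(p, q). exponent4 p q (r - p - q) 0) (SIGMA p:{..r}. {..r - p})"
    by (rule inj_onI, clarsimp) (metis lookup_exponent4 vec4_simps(1,2))
  then have "card (ternary r) = (\<Sum>p\<le>r. Suc (r - p))"
    unfolding ternary_def by (subst card_image) (simp_all add: card_SigmaI)
  also have "\<dots> = (\<Sum>p\<le>r. Suc p)"
    using sum.nat_diff_reindex[of Suc "Suc r"] by (simp only: lessThan_Suc_atMost diff_Suc_Suc)
  also have "2 * \<dots> = (r + 1) * (r + 2)"
    by (induction r) simp_all
  finally show ?thesis .
qed

lemma ternaryD:
  assumes "m \<in> ternary r"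
  shows "total_deg m = r" "Poly_Mapping.lookup m 4 = 0"
  using assms by (auto simp: ternary_def total_deg_def sum_4)

section \<open>Maximal rank and general linear forms in terms of representatives\<close>

lemma ideal_generated_subsetI:
  assumes "B \<subseteq> I" "0 \<in> I" "\<And>p q. p \<in> I \<Longrightarrow> q \<in> I \<Longrightarrow> p + q \<in> I" "\<And>p q. p \<in> I \<Longrightarrow> q * p \<in> I"
  shows "ideal_generated B \<subseteq> I"
proof -
  interpret module "(*) :: 'a \<Rightarrow> 'a \<Rightarrow> 'a" by unfold_locales (simp_all add: algebra_simps)
  show ?thesis unfolding ideal_generated_def
    by (rule span_minimal[OF assms(1)]) (use assms in \<open>simp add: subspace_def\<close>)
qed

lemma ideal_generated_closed:
  shows ideal_generated_base: "p \<in> B \<Longrightarrow> p \<in> ideal_generated B"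
    and ideal_generated_0: "0 \<in> ideal_generated B"
    and ideal_generated_add: "p \<in> ideal_generated B \<Longrightarrow> q \<in> ideal_generated B \<Longrightarrow> p + q \<in> ideal_generated B"
    and ideal_generated_diff: "p \<in> ideal_generated B \<Longrightarrow> q \<in> ideal_generated B \<Longrightarrow> p - q \<in> ideal_generated B"
    and ideal_generated_mult: "p \<in> ideal_generated B \<Longrightarrow> q * p \<in> ideal_generated B"
    and ideal_generated_sum: "(\<And>i. i \<in> A \<Longrightarrow> f i \<in> ideal_generated B) \<Longrightarrow> sum f A \<in> ideal_generated B"
proof -
  interpret module "(*) :: 'a \<Rightarrow> 'a \<Rightarrow> 'a" by unfold_locales (simp_all add: algebra_simps)
  show "p \<in> B \<Longrightarrow> p \<in> ideal_generated B" "0 \<in> ideal_generated B"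
    "p \<in> ideal_generated B \<Longrightarrow> q \<in> ideal_generated B \<Longrightarrow> p + q \<in> ideal_generated B"
    "p \<in> ideal_generated B \<Longrightarrow> q \<in> ideal_generated B \<Longrightarrow> p - q \<in> ideal_generated B"
    "p \<in> ideal_generated B \<Longrightarrow> q * p \<in> ideal_generated B"
    "(\<And>i. i \<in> A \<Longrightarrow> f i \<in> ideal_generated B) \<Longrightarrow> sum f A \<in> ideal_generated B"
    unfolding ideal_generated_def by (simp_all add: span_base span_zero span_add span_diff span_scale span_sum)
qed

lemma coset_eq_iff: "f +o ideal_generated B = g +o ideal_generated B \<longleftrightarrow> f - g \<in> ideal_generated B"
proof
  assume "f +o ideal_generated B = g +o ideal_generated B"
  moreover have "f \<in> f +o ideal_generated B"
    unfolding elt_set_plus_def using ideal_generated_0[of B] by force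
  ultimately obtain u where "u \<in> ideal_generated B" "f = g + u"
    unfolding elt_set_plus_def by auto
  then show "f - g \<in> ideal_generated B" by simp
next
  have "f +o ideal_generated B \<subseteq> g +o ideal_generated B" if "f - g \<in> ideal_generated B" for f g
  proof
    fix x assume "x \<in> f +o ideal_generated B"
    then obtain u where "u \<in> ideal_generated B" "x = f + u"
      unfolding elt_set_plus_def by auto
    then have "f - g + u \<in> ideal_generated B" "x = g + (f - g + u)"
      using ideal_generated_add[OF that] by simp_all
    then show "x \<in> g +o ideal_generated B" unfolding elt_set_plus_def by blast
  qed
  moreover assume "f - g \<in> ideal_generated B"
  moreover from this have "g - f \<in> ideal_generated B"
    using ideal_generated_diff[OF ideal_generated_0] by fastforce
  ultimately show "f +o ideal_generated B = g +o ideal_generated B" by blast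
qed

lemma max_rank_iff:
  fixes B :: "('n::finite, 'k::field) mpolynomial set"
  assumes l: "l \<in> homogeneous_part 1"
  shows "max_rank (ideal_generated B) l t \<longleftrightarrow>
    (\<forall>f\<in>homogeneous_part t. l * f \<in> ideal_generated B \<longrightarrow> f \<in> ideal_generated B) \<or>
    (\<forall>h\<in>homogeneous_part (t + 1). \<exists>f\<in>homogeneous_part t. h - l * f \<in> ideal_generated B)"
proof -
  define I where "I = ideal_generated B"
  have q: "quotient_mult I l (f +o I) = (l * f) +o I" for f
    unfolding I_def by (rule quotient_mult_coset)
  have eq: "f +o I = g +o I \<longleftrightarrow> f - g \<in> I" for f g
    unfolding I_def by (rule coset_eq_iff)
  have "inj_on (quotient_mult I l) (quotient_part I t) \<longleftrightarrow>
      (\<forall>f\<in>homogeneous_part t. \<forall>g\<in>homogeneous_part t. l * f - l * g \<in> I \<longrightarrow> f - g \<in> I)"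
    by (simp add: inj_on_def quotient_part_def q eq)
  also have "\<dots> \<longleftrightarrow> (\<forall>f\<in>homogeneous_part t. l * f \<in> I \<longrightarrow> f \<in> I)"
  proof (intro iffI ballI impI)
    fix f assume *: "\<forall>f\<in>homogeneous_part t. \<forall>g\<in>homogeneous_part t. l * f - l * g \<in> I \<longrightarrow> f - g \<in> I"
      and f: "f \<in> homogeneous_part t" "l * f \<in> I"
    from bspec[OF bspec[OF * f(1)] hom_0] f(2) show "f \<in> I" by simp
  next
    fix f g assume *: "\<forall>f\<in>homogeneous_part t. l * f \<in> I \<longrightarrow> f \<in> I"
      and fg: "f \<in> homogeneous_part t" "g \<in> homogeneous_part t" "l * f - l * g \<in> I"
    from bspec[OF * hom_diff[OF fg(1,2)]] fg(3) show "f - g \<in> I" by (simp add: right_diff_distrib)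
  qed
  finally have inj: "inj_on (quotient_mult I l) (quotient_part I t) \<longleftrightarrow>
    (\<forall>f\<in>homogeneous_part t. l * f \<in> I \<longrightarrow> f \<in> I)" .
  have "l * f \<in> homogeneous_part (t + 1)" if "f \<in> homogeneous_part t" for f
    using hom_mult[OF l that] by (simp add: add.commute)
  then have "quotient_mult I l ` quotient_part I t \<subseteq> quotient_part I (t + 1)"
    by (auto simp: quotient_part_def q)
  then have "quotient_mult I l ` quotient_part I t = quotient_part I (t + 1) \<longleftrightarrow>
      quotient_part I (t + 1) \<subseteq> quotient_mult I l ` quotient_part I t" by blast
  also have "\<dots> \<longleftrightarrow> (\<forall>h\<in>homogeneous_part (t + 1). \<exists>f\<in>homogeneous_part t. h +o I = l * f +o I)"
    by (auto simp: quotient_part_def image_image q subset_iff image_iff)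
  finally show ?thesis unfolding max_rank_def I_def[symmetric] inj by (simp add: eq)
qed

lemma power_ideal_iff:
  "p \<in> power_ideal a1 a2 a3 a4 a5 L \<longleftrightarrow> (\<exists>h. p - L ^ a5 * h \<in> monomial_ideal (vec4 a1 a2 a3 a4))"
proof
  define a where "a = vec4 a1 a2 a3 a4"
  define I where "I = {p. \<exists>h. p - L ^ a5 * h \<in> monomial_ideal a}"
  have "power_ideal a1 a2 a3 a4 a5 L \<subseteq> I"
    unfolding power_ideal_def
  proof (rule ideal_generated_subsetI)
    have "Var i ^ a i \<in> I" for i
      unfolding I_def using Var_power_in_monomial_ideal[of i a] by (intro CollectI exI[of _ 0]) simp
    from this[of 1] this[of 2] this[of 3] this[of 4]
    have vars: "{Var 1 ^ a1, Var 2 ^ a2, Var 3 ^ a3, Var 4 ^ a4} \<subseteq> I" by (simp add: a_def)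
    have "L ^ a5 \<in> I" unfolding I_def by (intro CollectI exI[of _ 1]) simp
    with vars show "{Var 1 ^ a1, Var 2 ^ a2, Var 3 ^ a3, Var 4 ^ a4, L ^ a5} \<subseteq> I" by simp
    show "0 \<in> I" unfolding I_def by (intro CollectI exI[of _ 0]) simp
    show "p + q \<in> I" if "p \<in> I" "q \<in> I" for p q
    proof -
      from that obtain g h where "p - L ^ a5 * g \<in> monomial_ideal a" "q - L ^ a5 * h \<in> monomial_ideal a"
        unfolding I_def by blast
      from monomial_ideal_add[OF this] show ?thesis
        unfolding I_def by (intro CollectI exI[of _ "g + h"]) (simp add: algebra_simps)
    qed
    show "q * p \<in> I" if "p \<in> I" for p q
    proof -
      from that obtain h where "p - L ^ a5 * h \<in> monomial_ideal a"
        unfolding I_def by blast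
      from monomial_ideal_mult[OF this, of q] show ?thesis
        unfolding I_def by (intro CollectI exI[of _ "q * h"]) (simp add: algebra_simps)
    qed
  qed
  moreover assume "p \<in> power_ideal a1 a2 a3 a4 a5 L"
  ultimately show "\<exists>h. p - L ^ a5 * h \<in> monomial_ideal (vec4 a1 a2 a3 a4)"
    by (auto simp: I_def a_def)
next
  define a where "a = vec4 a1 a2 a3 a4"
  define B where "B = {Var 1 ^ a1, Var 2 ^ a2, Var 3 ^ a3, Var 4 ^ a4, L ^ a5}"
  assume "\<exists>h. p - L ^ a5 * h \<in> monomial_ideal (vec4 a1 a2 a3 a4)"
  then obtain h where "p - L ^ a5 * h \<in> monomial_ideal a" by (auto simp: a_def)
  from monomial_ideal_eq_sum[OF this] obtain q where "p - L ^ a5 * h = (\<Sum>i\<in>UNIV. Var i ^ a i * q i)" .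
  then have p: "p = (\<Sum>i\<in>UNIV. q i * Var i ^ a i) + h * L ^ a5" by (simp add: algebra_simps)
  have "\<forall>i. Var i ^ a i \<in> B"
    unfolding all_4 by (simp add: B_def a_def)
  then have "p \<in> ideal_generated B"
    unfolding p by (intro ideal_generated_add ideal_generated_sum ideal_generated_mult ideal_generated_base)
      (auto simp: B_def)
  then show "p \<in> power_ideal a1 a2 a3 a4 a5 L" by (simp add: power_ideal_def B_def)
qed

definition component :: "int \<Rightarrow> ('n::finite, 'k::comm_ring_1) mpolynomial \<Rightarrow> ('n, 'k) mpolynomial" where
  "component t p = (\<Sum>m\<in>Poly_Mapping.keys p.
     if int (total_deg m) = t then Poly_Mapping.single m (Poly_Mapping.lookup p m) else 0)"

lemma component_add: "component t (p + q) = component t p + component t q"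
  unfolding component_def
  by (rule setsum_keys_plus_distrib) (simp_all add: single_add)

lemma component_single: "component t (Poly_Mapping.single m k) = (if int (total_deg m) = t then Poly_Mapping.single m k else 0)"
  by (simp add: component_def)

lemma component_0 [simp]: "component t 0 = 0"
  by (simp add: component_def)

lemma component_diff: "component t (p - q) = component t p - component t q"
  using component_add[of t "p - q" q] by simp

lemma lookup_component:
  "Poly_Mapping.lookup (component t p) m = (if int (total_deg m) = t then Poly_Mapping.lookup p m else 0)"
  by (induction p rule: poly_induct)
    (auto simp: component_single component_add lookup_add lookup_single when_def)

lemma component_hom: "p \<in> homogeneous_part u \<Longrightarrow> component t p = (if t = u then p else 0)"
  by (rule poly_mapping_eqI) (auto simp: lookup_component homogeneous_part_def in_keys_iff)

lemma hom_component: "component t p \<in> homogeneous_part t"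
  by (auto simp: homogeneous_part_def in_keys_iff lookup_component split: if_splits)

lemma component_mult_hom:
  assumes q: "q \<in> homogeneous_part d"
  shows "component t (q * p) = q * component (t - d) p"
proof (induction p rule: poly_induct)
  case (single m k)
  have "q * Poly_Mapping.single m k \<in> homogeneous_part (d + int (total_deg m))"
    by (intro hom_mult q hom_single refl)
  from component_hom[OF this, of t] show ?case by (auto simp: component_single)
qed (simp add: component_add distrib_left)

lemma component_monomial_ideal: "p \<in> monomial_ideal a \<Longrightarrow> component t p \<in> monomial_ideal a"
  by (auto simp: monomial_ideal_def in_keys_iff lookup_component split: if_splits)

lemma power_ideal_hom:
  assumes p: "p \<in> homogeneous_part t" "p \<in> power_ideal a1 a2 a3 a4 a5 (lform c)"
  obtains h where "h \<in> homogeneous_part (t - int a5)" "p - lform c ^ a5 * h \<in> monomial_ideal (vec4 a1 a2 a3 a4)"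
proof -
  from p(2) obtain h where h: "p - lform c ^ a5 * h \<in> monomial_ideal (vec4 a1 a2 a3 a4)"
    unfolding power_ideal_iff by blast
  have "lform c ^ a5 \<in> homogeneous_part (int a5)"
    using hom_power[OF hom_lform, of c a5] by simp
  then have "component t (p - lform c ^ a5 * h) = p - lform c ^ a5 * component (t - int a5) h"
    using component_hom[OF p(1), of t] by (simp add: component_diff component_mult_hom)
  with component_monomial_ideal[OF h, of t] show ?thesis
    using that[OF hom_component] by simp
qed

lemma for_general_linear_formI:
  assumes "eval_at c0 f \<noteq> 0" and "\<And>c. eval_at c f \<noteq> 0 \<Longrightarrow> P (lform c)"
  shows "for_general_linear_form P"
  unfolding for_general_linear_form_def
proof (intro exI conjI ballI impI)
  show "zariski_open {c. eval_at c f \<noteq> 0}"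
    unfolding zariski_open_def by (intro exI[of _ "{f}"]) simp
  show "{c. eval_at c f \<noteq> 0} \<noteq> {}" using assms(1) by blast
  fix l assume "l \<in> homogeneous_part 1" "linear_coeffs l \<in> {c. eval_at c f \<noteq> 0}"
  then show "P l" using assms(2)[of "linear_coeffs l"] hom_1_eq_lform[of l] by simp
qed

text \<open>A pair of linear forms in general position: any three of the forms \<open>Var 1\<close>, \<open>Var 2\<close>, \<open>Var 3\<close>,
  \<open>Var 4\<close> and \<open>lform c\<close> are independent modulo \<open>lform b\<close>. That all \<open>c i\<close> are nonzero gives the strong
  Lefschetz property for \<open>lform c\<close>.\<close>

locale general_pair =
  fixes b c :: "4 \<Rightarrow> 'k::field_char_0"
  assumes b_nonzero: "b i \<noteq> 0" and c_nonzero: "c i \<noteq> 0"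
    and minors_nonzero: "i \<noteq> j \<Longrightarrow> b j * c i - b i * c j \<noteq> 0"

text \<open>The conditions on \<open>b\<close> are the nonvanishing of a polynomial that depends on \<open>c\<close>. It is not
  identically zero if all \<open>c i\<close> are nonzero, as the point with coordinates \<open>i * c i\<close> shows.\<close>

lemma for_general_pair:
  fixes P :: "(4, 'k::field_char_0) mpolynomial \<Rightarrow> (4, 'k) mpolynomial \<Rightarrow> bool"
  assumes "\<And>b c. general_pair b c \<Longrightarrow> P (lform c) (lform b)"
  shows "for_general_linear_form (\<lambda>L. for_general_linear_form (P L))"
proof (rule for_general_linear_formI)
  show "eval_at (\<lambda>_. 1) (\<Prod>i\<in>UNIV. Var i :: (4, 'k) mpolynomial) \<noteq> 0"
    by (simp add: eval_at_prod)
  fix c :: "4 \<Rightarrow> 'k"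
  assume "eval_at c (\<Prod>i\<in>UNIV. Var i) \<noteq> 0"
  then have c: "c i \<noteq> 0" for i by (simp add: eval_at_prod)
  define m where "m i j = const (c i) * Var j - const (c j) * Var i" for i j :: 4
  define f where "f = (\<Prod>i\<in>UNIV. Var i) * (m 1 2 * m 1 3 * m 1 4 * m 2 3 * m 2 4 * m 3 4)"
  have m: "eval_at b (m i j) = b j * c i - b i * c j" for b i j
    by (simp add: m_def eval_at_diff eval_at_mult mult.commute)
  show "for_general_linear_form (P (lform c))"
  proof (rule for_general_linear_formI)
    show "eval_at (vec4 (c 1) (2 * c 2) (3 * c 3) (4 * c 4)) f \<noteq> 0"
      unfolding f_def eval_at_mult eval_at_prod m prod_4 by (simp add: c del: neq_4)
    fix b assume "eval_at b f \<noteq> 0"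
    then have nz: "b 1 \<noteq> 0 \<and> b 2 \<noteq> 0 \<and> b 3 \<noteq> 0 \<and> b 4 \<noteq> 0"
      "b 2 * c 1 \<noteq> b 1 * c 2 \<and> b 3 * c 1 \<noteq> b 1 * c 3 \<and> b 4 * c 1 \<noteq> b 1 * c 4
        \<and> b 3 * c 2 \<noteq> b 2 * c 3 \<and> b 4 * c 2 \<noteq> b 2 * c 4 \<and> b 4 * c 3 \<noteq> b 3 * c 4"
      unfolding f_def eval_at_mult eval_at_prod m prod_4 eval_at_Var
      by (simp_all only: mult_eq_0_iff de_Morgan_disj right_minus_eq simp_thms)
    have "\<forall>i. b i \<noteq> 0" unfolding all_4 by (rule nz(1))
    moreover have "\<forall>i j. i \<noteq> j \<longrightarrow> b j * c i - b i * c j \<noteq> 0"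
      unfolding all_4 right_minus_eq using nz(2) by (simp add: eq_commute)
    ultimately
    show "P (lform c) (lform b)"
      using c by (intro assms general_pair.intro) auto
  qed
qed

section \<open>Degree bounds and inverse systems\<close>

lemma degree_along_le_const_mult:
  fixes F :: "('n::finite, 'k::comm_ring_1) mpolynomial"
  shows "degree_along_le (dir c) n F \<Longrightarrow> degree_along_le (dir c) n (const k * F)"
  using degree_along_le_mult[OF derivation_dir degree_along_le_0, of c "const k" n F] by simp

lemma degree_along_pd_const_mult:
  fixes F :: "('n::finite, 'k::comm_ring_1) mpolynomial"
  shows "degree_along_le (pd i) n F \<Longrightarrow> degree_along_le (pd i) n (const k * F)"
  unfolding pd_eq_dir by (rule degree_along_le_const_mult)

lemma funpow_pd_single_eq_0:
  "Poly_Mapping.lookup m i \<le> n \<Longrightarrow> degree_along_le (pd i) n (Poly_Mapping.single m k)"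
proof (induction n arbitrary: m k)
  case 0
  then show ?case by (simp add: degree_along_le_def pd_single)
next
  case (Suc n)
  have "Poly_Mapping.lookup (m - Poly_Mapping.single i 1) i \<le> n"
    using Suc.prems by (simp add: lookup_minus)
  from Suc.IH[OF this] show ?case
    by (simp only: degree_along_le_def pd_single funpow_Suc_right comp_apply)
qed

lemma degree_along_pd_if_keys:
  assumes "\<And>m. m \<in> Poly_Mapping.keys F \<Longrightarrow> Poly_Mapping.lookup m i \<le> n"
  shows "degree_along_le (pd i) n F"
proof -
  have "degree_along_le (pd i) n (\<Sum>m\<in>A. Poly_Mapping.single m (Poly_Mapping.lookup F m))"
    if "A \<subseteq> Poly_Mapping.keys F" for A
    using finite_subset[OF that finite_keys] that
  proof (induction A rule: finite_induct)
    case empty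
    show ?case by (simp add: degree_along_le_def funpow_derivation[OF derivation_pd] derivation_0[OF derivation_pd])
  next
    case (insert m A)
    have "degree_along_le (pd i) n (Poly_Mapping.single m (Poly_Mapping.lookup F m))"
      using insert.prems by (intro funpow_pd_single_eq_0 assms) simp
    then show ?case using insert
      by (simp add: degree_along_le_add[OF derivation_pd])
  qed
  then show ?thesis using poly_eq_sum_monomials[of F] by (metis subset_refl)
qed

lemma pairing_eq_sum:
  assumes "finite Y" "Poly_Mapping.keys F \<subseteq> Y"
  shows "pairing g F = (\<Sum>y\<in>Y. Poly_Mapping.lookup g y * (mfact y * Poly_Mapping.lookup F y))"
proof -
  have "pairing g F = (\<Sum>y\<in>Poly_Mapping.keys g \<union> Y. Poly_Mapping.lookup g y * (mfact y * Poly_Mapping.lookup F y))"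
    unfolding pairing_def by (rule sum.mono_neutral_left) (use assms in \<open>auto simp: in_keys_iff\<close>)
  also have "\<dots> = (\<Sum>y\<in>Y. Poly_Mapping.lookup g y * (mfact y * Poly_Mapping.lookup F y))"
    by (rule sum.mono_neutral_right) (use assms in \<open>auto simp: in_keys_iff\<close>)
  finally show ?thesis .
qed

text \<open>The forms of degree \<open>t\<close> in the inverse system of the ideal generated by \<open>monomial_ideal a\<close>
  and \<open>lform b\<close>.\<close>

definition apolar :: "('n::finite \<Rightarrow> 'k) \<Rightarrow> ('n \<Rightarrow> nat) \<Rightarrow> int \<Rightarrow> ('n, 'k::field_char_0) mpolynomial set" where
  "apolar b a t = {F. Poly_Mapping.keys F \<subseteq> box a t \<and> dir b F = 0}"

lemma apolar_hom: "F \<in> apolar b a t \<Longrightarrow> F \<in> homogeneous_part t"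
  by (auto simp: apolar_def homogeneous_part_def box_def)

lemma apolarI:
  assumes "F \<in> homogeneous_part t" "\<And>i. degree_along_le (pd i) (a i - 1) F" "\<And>i. 0 < a i" "dir b F = 0"
  shows "F \<in> apolar b a t"
  unfolding apolar_def
proof (intro CollectI conjI subsetI)
  fix m assume m: "m \<in> Poly_Mapping.keys F"
  then have "Poly_Mapping.lookup m i < a i" for i
    using degree_along_pd_keys[OF assms(2) m, of i] assms(3)[of i] by linarith
  then show "m \<in> box a t" using m assms(1) by (simp add: box_def homogeneous_part_def)
qed fact

lemma pairing_monomial_ideal_apolar:
  assumes "p \<in> monomial_ideal a" "F \<in> apolar b a t"
  shows "pairing p F = 0"
  unfolding pairing_def
proof (rule sum.neutral, rule ballI)
  fix m assume "m \<in> Poly_Mapping.keys p"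
  then obtain i where "a i \<le> Poly_Mapping.lookup m i" using assms(1) by (auto simp: monomial_ideal_def)
  then have "m \<notin> box a t" unfolding box_def by (simp add: not_less) blast
  then have "Poly_Mapping.lookup F m = 0" using assms(2) by (auto simp: apolar_def in_keys_iff)
  then show "Poly_Mapping.lookup p m * (mfact m * Poly_Mapping.lookup F m) = 0" by simp
qed

lemma pairing_lform_apolar: "F \<in> apolar b a t \<Longrightarrow> pairing (lform b * g) F = 0"
  by (simp add: pairing_lform_mult apolar_def)

section \<open>Brackets and the conic through the five points\<close>

lemma dir_Var_diff: "dir d (const x * Var i - const y * Var j) = const (x * d i - y * d j)"
  by (simp add: derivation_diff[OF derivation_dir] dir_const_mult dir_Var mult_single const_diff)

context general_pair
begin

text \<open>Modulo \<open>b\<close>, the line through the coordinate points of the two variables other than \<open>i\<close> and \<open>j\<close>.\<close>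

definition bracket :: "4 \<Rightarrow> 4 \<Rightarrow> (4, 'k) mpolynomial" where
  "bracket i j = const (b j) * Var i - const (b i) * Var j"

lemma hom_bracket: "bracket i j \<in> homogeneous_part 1"
  unfolding bracket_def by (intro hom_diff hom_const_mult hom_Var)

lemma dir_bracket: "dir d (bracket i j) = const (b j * d i - b i * d j)"
  unfolding bracket_def by (rule dir_Var_diff)

lemma eval_bracket: "eval_at y (bracket i j) = b j * y i - b i * y j"
  by (simp add: bracket_def eval_at_diff eval_at_mult)

lemma degree_along_pd_bracket: "degree_along_le (pd k) (if k = i \<or> k = j then 1 else 0) (bracket i j)"
  by (simp add: pd_eq_dir degree_along_le_def dir_bracket)

text \<open>The member through \<open>c\<close> of the pencil of conics through the four coordinate points.\<close>

definition conic :: "(4, 'k) mpolynomial" where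
  "conic = const (eval_at c (bracket 1 3 * bracket 2 4)) * (bracket 1 2 * bracket 3 4)
         - const (eval_at c (bracket 1 2 * bracket 3 4)) * (bracket 1 3 * bracket 2 4)"

lemma hom_conic: "conic \<in> homogeneous_part 2"
proof -
  have "bracket i j * bracket k l \<in> homogeneous_part 2" for i j k l
    using hom_mult[OF hom_bracket hom_bracket] by simp
  then show ?thesis unfolding conic_def by (intro hom_diff hom_const_mult)
qed

lemma dir_b_bracket [simp]: "dir b (bracket i j) = 0"
  by (simp add: dir_bracket)

lemma dir_conic: "dir b conic = 0"
  by (simp add: conic_def derivation_diff[OF derivation_dir] derivation_mult[OF derivation_dir])

lemma eval_conic: "eval_at c conic = 0"
  by (simp add: conic_def eval_at_diff eval_at_mult)

lemma degree_along_dir_conic: "degree_along_le (dir c) 1 conic"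
  using funpow_dir_self[of conic 2 c] hom_conic
  by (simp add: degree_along_le_def eval_conic numeral_2_eq_2)

lemma degree_along_pd_conic: "degree_along_le (pd i) 1 conic"
proof -
  have "degree_along_le (pd k) 1 (bracket 1 2 * bracket 3 4)" "degree_along_le (pd k) 1 (bracket 1 3 * bracket 2 4)" for k
  proof -
    have "\<forall>k. degree_along_le (pd k) 1 (bracket 1 2 * bracket 3 4)"
      unfolding all_4
      using degree_along_le_mult[OF derivation_pd degree_along_pd_bracket degree_along_pd_bracket, of _ 1 2 3 4]
      by (auto split: if_splits dest: meta_spec[of _ 1] meta_spec[of _ 2] meta_spec[of _ 3] meta_spec[of _ 4])
    then show "degree_along_le (pd k) 1 (bracket 1 2 * bracket 3 4)" by blast
    have "\<forall>k. degree_along_le (pd k) 1 (bracket 1 3 * bracket 2 4)"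
      unfolding all_4
      using degree_along_le_mult[OF derivation_pd degree_along_pd_bracket degree_along_pd_bracket, of _ 1 3 2 4]
      by (auto split: if_splits dest: meta_spec[of _ 1] meta_spec[of _ 2] meta_spec[of _ 3] meta_spec[of _ 4])
    then show "degree_along_le (pd k) 1 (bracket 1 3 * bracket 2 4)" by blast
  qed
  then show ?thesis
    unfolding conic_def by (intro degree_along_le_diff[OF derivation_pd] degree_along_pd_const_mult)
qed

lemma conic_nonzero: "conic \<noteq> 0"
proof
  assume "conic = 0"
  \<comment> \<open>The point lies on the line \<open>bracket 1 3\<close> and on neither of the lines \<open>bracket 1 2\<close>, \<open>bracket 3 4\<close>.\<close>
  moreover have "eval_at (vec4 0 (b 2) 0 (2 * b 4)) conic
      = (b 4 * c 2 - b 2 * c 4) * ((b 3 * c 1 - b 1 * c 3) * (2 * (b 1 * b 2) * (b 3 * b 4)))"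
    by (simp add: conic_def eval_at_diff eval_at_mult eval_bracket algebra_simps)
  moreover have "b 4 * c 2 - b 2 * c 4 \<noteq> 0" "b 3 * c 1 - b 1 * c 3 \<noteq> 0"
    by (simp_all only: minors_nonzero neq_4 not_False_eq_True)
  ultimately show False using b_nonzero by simp
qed

text \<open>Multiplication by the \<open>r\<close>-th power of the conic raises all degree bounds by \<open>r\<close>, also the one
  in the direction \<open>c\<close>. For a form of degree \<open>a5 - r\<close> that last bound only demands that it vanish
  at \<open>c\<close>.\<close>

lemma conic_power_apolar:
  assumes G: "G \<in> apolar b (\<lambda>i. a i - r) (t - 2 * int r)" and Gc: "eval_at c G = 0"
    and t: "t = int a5 + int r" and r: "\<And>i. r < a i" "r < a5"
  shows "conic ^ r * G \<in> apolar b a t" and "(dir c ^^ a5) (conic ^ r * G) = 0"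
proof -
  show "conic ^ r * G \<in> apolar b a t"
  proof (rule apolarI)
    show "conic ^ r * G \<in> homogeneous_part t"
      using hom_mult[OF hom_power[OF hom_conic] apolar_hom[OF G], of r] by simp
    show "0 < a i" for i using r(1)[of i] by simp
    show "dir b (conic ^ r * G) = 0"
      using G by (simp add: apolar_def derivation_mult[OF derivation_dir] derivation_power[OF derivation_dir] dir_conic)
    fix i
    have "degree_along_le (pd i) (a i - r - 1) G"
    proof (rule degree_along_pd_if_keys)
      fix m assume "m \<in> Poly_Mapping.keys G"
      then have "Poly_Mapping.lookup m i < a i - r" using G by (auto simp: apolar_def box_def)
      then show "Poly_Mapping.lookup m i \<le> a i - r - 1" by simp
    qed
    from degree_along_le_mult[OF derivation_pd degree_along_le_power[OF derivation_pd degree_along_pd_conic, of i r] this]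
    show "degree_along_le (pd i) (a i - 1) (conic ^ r * G)" using r(1)[of i] by simp
  qed
  have "t - 2 * int r = int (a5 - r)" using t r(2) by simp
  then have "G \<in> homogeneous_part (int (a5 - r))" using apolar_hom[OF G] by simp
  from funpow_dir_self[OF this, of c] have "degree_along_le (dir c) (a5 - r - 1) G"
    using r(2) Gc by (simp add: degree_along_le_def Suc_diff_Suc)
  from degree_along_le_mult[OF derivation_dir degree_along_le_power[OF derivation_dir degree_along_dir_conic, of r] this]
  have "degree_along_le (dir c) (a5 - 1) (conic ^ r * G)" using r(2) by simp
  then show "(dir c ^^ a5) (conic ^ r * G) = 0" using r(2) by (simp add: degree_along_le_def)
qed

end

section \<open>Failure of maximal rank\<close>

lemma const_mult_eq_0D:
  fixes k :: "'k::idom"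
  assumes "const k * p = 0" "k \<noteq> 0"
  shows "p = 0"
proof (rule poly_mapping_eqI)
  fix m
  have "k * Poly_Mapping.lookup p m = 0"
    using arg_cong[OF assms(1), of "\<lambda>q. Poly_Mapping.lookup q m"] by (simp add: lookup_const_mult)
  with assms(2) show "Poly_Mapping.lookup p m = Poly_Mapping.lookup 0 m" by simp
qed

text \<open>The highest nonvanishing derivative of \<open>v\<close> in the \<open>i\<close>-th variable yields a nonvanishing
  derivative of \<open>lform b * v\<close> of one order more. So a linear form involving the variable \<open>i\<close> does not
  divide a nonzero polynomial free of it.\<close>

lemma lform_mult_pd_eq_0:
  fixes v :: "('n::finite, 'k::field_char_0) mpolynomial"
  assumes b: "b i \<noteq> 0" and "pd i (lform b * v) = 0"
  shows "v = 0"
proof -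
  have pow: "(pd i ^^ Suc n) (lform b * v) = lform b * (pd i ^^ Suc n) v + const (of_nat (Suc n) * b i) * (pd i ^^ n) v" for n
  proof (induction n)
    case 0
    show ?case by (simp add: pd_mult pd_lform)
  next
    case (Suc n)
    have k: "const (of_nat (Suc (Suc n)) * b i) = const (b i) + const (of_nat (Suc n) * b i)"
      unfolding const_add[symmetric] by (simp add: algebra_simps)
    have "(pd i ^^ Suc (Suc n)) (lform b * v) = pd i ((pd i ^^ Suc n) (lform b * v))" by simp
    also have "\<dots> = lform b * (pd i ^^ Suc (Suc n)) v + const (of_nat (Suc (Suc n)) * b i) * (pd i ^^ Suc n) v"
      unfolding Suc k by (simp add: pd_add pd_mult pd_lform distrib_right del: of_nat_Suc)
    finally show ?case .
  qed
  have "(pd i ^^ n) v = 0 \<Longrightarrow> v = 0" for n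
  proof (induction n)
    case (Suc n)
    have "(pd i ^^ Suc n) (lform b * v) = 0"
      using assms(2) funpow_derivation(1)[OF derivation_pd, of n i] by (simp only: funpow_Suc_right comp_apply)
    with pow[of n] Suc.prems have "const (of_nat (Suc n) * b i) * (pd i ^^ n) v = 0" by simp
    moreover have "of_nat (Suc n) * b i \<noteq> 0" using b by (simp del: of_nat_Suc)
    ultimately have "(pd i ^^ n) v = 0" by (rule const_mult_eq_0D)
    with Suc.IH show ?case by simp
  qed simp
  moreover have "degree_along_le (pd i) (\<Sum>m\<in>Poly_Mapping.keys v. Poly_Mapping.lookup m i) v"
    by (rule degree_along_pd_if_keys) (rule member_le_sum, simp_all)
  ultimately show ?thesis unfolding degree_along_le_def by blast
qed

lemma lookup_linear_combination:
  fixes h :: "('n, 'k::comm_ring_1) mpolynomial \<Rightarrow> ('n, 'k) mpolynomial"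
  assumes "\<And>p q. h (p + q) = h p + h q" "\<And>k p. h (const k * p) = const k * h p"
  shows "Poly_Mapping.lookup (h (\<Sum>z\<in>Z. Poly_Mapping.single z (v z))) y
    = (\<Sum>z\<in>Z. Poly_Mapping.lookup (h (Poly_Mapping.single z 1)) y * v z)"
proof -
  have h0: "h 0 = 0" using assms(1)[of 0 0] by simp
  have "h (\<Sum>z\<in>Z. Poly_Mapping.single z (v z)) = (\<Sum>z\<in>Z. h (Poly_Mapping.single z (v z)))"
    by (induction Z rule: infinite_finite_induct) (simp_all add: assms(1) h0)
  moreover have "h (Poly_Mapping.single z (v z)) = const (v z) * h (Poly_Mapping.single z 1)" for z
    by (subst single_eq_const_mult) (rule assms(2))
  ultimately show ?thesis by (simp add: lookup_sum lookup_const_mult mult.commute)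
qed

lemma lookup_sum_single:
  "finite Z \<Longrightarrow> Poly_Mapping.lookup (\<Sum>z\<in>Z. Poly_Mapping.single z (v z)) m = (if m \<in> Z then v m else 0)"
  by (simp add: lookup_sum lookup_single when_def)

lemma sum_single_eq_0D:
  "(\<Sum>z\<in>Z. Poly_Mapping.single z (v z)) = 0 \<Longrightarrow> finite Z \<Longrightarrow> z \<in> Z \<Longrightarrow> v z = 0"
  by (metis lookup_sum_single lookup_zero)

lemma keys_sum_single_subset: "finite Z \<Longrightarrow> Poly_Mapping.keys (\<Sum>z\<in>Z. Poly_Mapping.single z (v z)) \<subseteq> Z"
  by (auto simp: in_keys_iff lookup_sum_single split: if_splits)

lemma keys_dir_box:
  assumes "Poly_Mapping.keys G \<subseteq> box a t"
  shows "Poly_Mapping.keys (dir b G) \<subseteq> box a (t - 1)"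
proof
  fix m assume "m \<in> Poly_Mapping.keys (dir b G)"
  then have "(\<Sum>i\<in>UNIV. b i * Poly_Mapping.lookup (pd i G) m) \<noteq> 0"
    by (simp add: in_keys_iff dir_def lookup_sum lookup_const_mult)
  then obtain i where "Poly_Mapping.lookup (pd i G) m \<noteq> 0"
    by (metis (no_types, lifting) mult_zero_right sum.neutral)
  then have "m + Poly_Mapping.single i 1 \<in> Poly_Mapping.keys G"
    by (auto simp: in_keys_iff lookup_pd)
  then have m: "m + Poly_Mapping.single i 1 \<in> box a t" using assms by blast
  have "Poly_Mapping.lookup m j < a j" for j
  proof -
    have "Poly_Mapping.lookup (m + Poly_Mapping.single i 1) j < a j" using m by (simp add: box_def)
    then show ?thesis by (simp add: lookup_add)
  qed
  with m show "m \<in> box a (t - 1)" by (simp add: box_def total_deg_add)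
qed

context general_pair
begin

text \<open>The linear conditions on the coefficients of a polynomial supported on \<open>box a t\<close> to lie in
  \<open>apolar b a t\<close> and to vanish at \<open>c\<close>; \<open>None\<close> stands for the latter.\<close>

definition conditions :: "(4 \<Rightarrow> nat) \<Rightarrow> int \<Rightarrow> (4 \<Rightarrow>\<^sub>0 nat) option set" where
  "conditions a t = insert None (Some ` box a (t - 1))"

definition condition :: "(4 \<Rightarrow>\<^sub>0 nat) option \<Rightarrow> (4 \<Rightarrow>\<^sub>0 nat) \<Rightarrow> 'k" where
  "condition e z = (case e of None \<Rightarrow> eval_at c (Poly_Mapping.single z 1)
    | Some m \<Rightarrow> Poly_Mapping.lookup (dir b (Poly_Mapping.single z 1)) m)"

lemma card_conditions: "card (conditions a t) = card (box a (t - 1)) + 1"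
  unfolding conditions_def by (subst card_insert_disjoint) (auto simp: card_image)

lemma apolar_if_conditions:
  assumes C0: "\<forall>e\<in>conditions a t. (\<Sum>z\<in>box a t. condition e z * v z) = 0"
  defines "G \<equiv> \<Sum>z\<in>box a t. Poly_Mapping.single z (v z)"
  shows "G \<in> apolar b a t" "eval_at c G = 0"
proof -
  have keys: "Poly_Mapping.keys G \<subseteq> box a t"
    unfolding G_def by (rule keys_sum_single_subset) simp
  have "dir b G = 0"
  proof (rule poly_mapping_eqI)
    fix m
    show "Poly_Mapping.lookup (dir b G) m = Poly_Mapping.lookup 0 m"
    proof (cases "m \<in> box a (t - 1)")
      case True
      have "Poly_Mapping.lookup (dir b G) m
          = (\<Sum>z\<in>box a t. Poly_Mapping.lookup (dir b (Poly_Mapping.single z 1)) m * v z)"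
        unfolding G_def
        by (rule lookup_linear_combination) (simp_all add: derivation_add[OF derivation_dir] dir_const_mult)
      also have "\<dots> = 0" using bspec[OF C0, of "Some m"] True by (simp add: conditions_def condition_def)
      finally show ?thesis by simp
    next
      case False
      with keys_dir_box[OF keys, of b] show ?thesis by (auto simp: in_keys_iff)
    qed
  qed
  with keys show "G \<in> apolar b a t" by (simp add: apolar_def)
  have "eval_at c G = (\<Sum>z\<in>box a t. eval_at c (Poly_Mapping.single z 1) * v z)"
    unfolding G_def eval_at_sum by (intro sum.cong refl) (simp add: eval_at_single)
  also have "\<dots> = 0" using bspec[OF C0, of None] by (simp add: conditions_def condition_def)
  finally show "eval_at c G = 0" .
qed

lemma exists_apolar_vanishing:
  assumes "card (box a (t - 1)) + 1 < card (box a t)"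
  obtains G where "G \<in> apolar b a t" "eval_at c G = 0" "G \<noteq> 0"
proof -
  have "card (conditions a t) < card (box a t)" using assms by (simp add: card_conditions)
  then obtain v where v: "\<exists>z\<in>box a t. v z \<noteq> 0"
    "\<forall>e\<in>conditions a t. (\<Sum>z\<in>box a t. condition e z * v z) = 0"
    using underdetermined_system[of "conditions a t" "box a t" condition] by (auto simp: conditions_def)
  define G where "G = (\<Sum>z\<in>box a t. Poly_Mapping.single z (v z))"
  have "G \<noteq> 0"
  proof
    assume "G = 0"
    then have "\<forall>z\<in>box a t. v z = 0"
      unfolding G_def by (intro ballI sum_single_eq_0D[OF _ finite_box])
    with v(1) show False by blast
  qed
  with apolar_if_conditions[OF v(2)] show ?thesis unfolding G_def[symmetric] by (intro that)
qed

text \<open>As a functional, \<open>F\<close> vanishes on the ideal and on the multiples of \<open>lform b\<close>, but not on the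
  monomials that occur in \<open>F\<close>.\<close>

lemma not_surjective:
  fixes a :: "4 \<Rightarrow> nat"
  assumes F: "F \<in> apolar b a t" "(dir c ^^ a5) F = 0" "F \<noteq> 0"
  shows "\<exists>h\<in>homogeneous_part t. \<forall>f g. h - lform b * f - lform c ^ a5 * g \<notin> monomial_ideal a"
proof -
  from F(3) obtain m where m: "m \<in> Poly_Mapping.keys F" by (auto simp flip: keys_eq_empty)
  define h where "h = (Poly_Mapping.single m 1 :: (4, 'k) mpolynomial)"
  have "h \<in> homogeneous_part t"
    using m apolar_hom[OF F(1)] unfolding h_def by (intro hom_single) (simp add: homogeneous_part_def)
  moreover have "h - lform b * f - lform c ^ a5 * g \<notin> monomial_ideal a" for f g
  proof
    assume "h - lform b * f - lform c ^ a5 * g \<in> monomial_ideal a"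
    from pairing_monomial_ideal_apolar[OF this F(1)] have "pairing h F = 0"
      by (simp add: pairing_diff_left pairing_lform_apolar[OF F(1)] pairing_lform_power_mult F(2))
    with m show False by (simp add: h_def pairing_single in_keys_iff)
  qed
  ultimately show ?thesis by blast
qed

text \<open>In degree \<open>t\<close> of the quotient \<open>A\<close> by \<open>monomial_ideal a\<close>, the multiples of \<open>lform b\<close> and of
  \<open>lform c ^ a5\<close> are orthogonal to the apolar multiples of the power of the conic. By the assumption
  on cardinalities this leaves them so little room that there must be a relation \<open>lform b * g + lform c ^ a5 * u = 0\<close> in \<open>A\<close> in which \<open>u\<close> is a form in the
  first three variables. It is not a multiple of the Koszul relation, as \<open>lform b\<close> does not divide \<open>u\<close>.\<close>

lemma not_injective:
  fixes a :: "4 \<Rightarrow> nat"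
  assumes t: "t = int a5 + int r" and socle: "2 * t + 1 = (\<Sum>i\<in>UNIV. int (a i) - 1)"
    and r: "\<And>i. r < a i" "r < a5"
    and card: "card (box a t) + (card (box (\<lambda>i. a i - r) (t - 2 * int r - 1)) + 1)
      < card (box a (t - 1)) + card (ternary r) + card (box (\<lambda>i. a i - r) (t - 2 * int r))"
  shows "\<exists>g\<in>homogeneous_part (t - 1). (\<exists>u. lform b * g - lform c ^ a5 * u \<in> monomial_ideal a) \<and>
    (\<forall>v\<in>homogeneous_part (int r - 1). g - lform c ^ a5 * v \<notin> monomial_ideal a)"
proof -
  define a' where "a' = (\<lambda>i. a i - r)"
  define t' where "t' = t - 2 * int r"
  define X where "X = box a (t - 1) <+> ternary r"
  define Z where "Z = box a' t'"
  define E where "E = conditions a' t'"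
  define p where "p x = (case x of Inl m \<Rightarrow> lform b * Poly_Mapping.single m 1
    | Inr m \<Rightarrow> lform c ^ a5 * Poly_Mapping.single m 1)" for x :: "(4 \<Rightarrow>\<^sub>0 nat) + (4 \<Rightarrow>\<^sub>0 nat)"
  define T where "T y x = Poly_Mapping.lookup (p x) y" for y x
  define S where "S y z = mfact y * Poly_Mapping.lookup (conic ^ r * Poly_Mapping.single z 1) y" for y z
  define C where "C = condition"
  define G where "G v = (\<Sum>z\<in>Z. Poly_Mapping.single z (v z))" for v :: "(4 \<Rightarrow>\<^sub>0 nat) \<Rightarrow> 'k"
  have finX: "finite X" by (simp add: X_def)
  have finZ: "finite Z" by (simp add: Z_def)
  have S: "(\<Sum>z\<in>Z. S y z * v z) = mfact y * Poly_Mapping.lookup (conic ^ r * G v) y"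
    for y and v :: "(4 \<Rightarrow>\<^sub>0 nat) \<Rightarrow> 'k"
  proof -
    have "Poly_Mapping.lookup (conic ^ r * G v) y
        = (\<Sum>z\<in>Z. Poly_Mapping.lookup (conic ^ r * Poly_Mapping.single z 1) y * v z)"
      unfolding G_def by (rule lookup_linear_combination[where h = "(*) (conic ^ r)"]) (simp_all add: distrib_left mult.left_commute)
    then show ?thesis by (simp add: S_def sum_distrib_left mult.assoc)
  qed
  have G_apolar: "G v \<in> apolar b a' t'" and G_eval: "eval_at c (G v) = 0"
    if "\<forall>e\<in>E. (\<Sum>z\<in>Z. C e z * v z) = 0" for v
    using apolar_if_conditions[of a' t' v] that by (simp_all add: E_def Z_def C_def G_def)
  have F: "conic ^ r * G v \<in> apolar b a t" "(dir c ^^ a5) (conic ^ r * G v) = 0"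
    if "\<forall>e\<in>E. (\<Sum>z\<in>Z. C e z * v z) = 0" for v
    using conic_power_apolar[of "G v" a r t a5] G_apolar[OF that] G_eval[OF that] t r
    by (simp_all add: a'_def t'_def)
  have "\<exists>w. (\<exists>x\<in>X. w x \<noteq> 0) \<and> (\<forall>y\<in>box a t. (\<Sum>x\<in>X. T y x * w x) = 0)"
  proof (rule kernel_nontrivial_if_orthogonal[where S = S and C = C and E = E and Z = Z])
    show "finite X" "finite (box a t)" "finite Z" "finite E"
      using finX finZ by (simp_all add: E_def conditions_def)
    fix v assume C0: "\<forall>e\<in>E. (\<Sum>z\<in>Z. C e z * v z) = 0"
    note Fv = F[OF C0]
    show "\<forall>z\<in>Z. v z = 0" if S0: "\<forall>y\<in>box a t. (\<Sum>z\<in>Z. S y z * v z) = 0"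
    proof -
      have "conic ^ r * G v = 0"
      proof (rule poly_mapping_eqI)
        fix y
        show "Poly_Mapping.lookup (conic ^ r * G v) y = Poly_Mapping.lookup 0 y"
          using Fv(1) S0 by (cases "y \<in> box a t") (auto simp: S apolar_def in_keys_iff)
      qed
      then have "G v = 0" using conic_nonzero by simp
      then show ?thesis unfolding G_def using sum_single_eq_0D[OF _ finZ, of v] by blast
    qed
    show "(\<Sum>y\<in>box a t. (\<Sum>z\<in>Z. S y z * v z) * T y x) = 0" if "x \<in> X" for x
    proof -
      have "(\<Sum>y\<in>box a t. (\<Sum>z\<in>Z. S y z * v z) * T y x) = pairing (p x) (conic ^ r * G v)"
      proof -
        have "Poly_Mapping.keys (conic ^ r * G v) \<subseteq> box a t" using Fv(1) by (simp add: apolar_def)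
        note eq = pairing_eq_sum[OF finite_box this, of "p x"]
        show ?thesis unfolding eq S T_def by (intro sum.cong refl mult.commute)
      qed
      also have "\<dots> = 0"
        by (cases x) (simp_all add: p_def pairing_lform_apolar[OF Fv(1)] pairing_lform_power_mult Fv(2))
      finally show ?thesis .
    qed
  next
    show "card (box a t) + card E < card X + card Z"
      using card by (simp add: X_def Z_def E_def card_conditions card_Plus a'_def t'_def)
  qed
  then obtain w where w: "\<exists>x\<in>X. w x \<noteq> 0" "\<And>y. y \<in> box a t \<Longrightarrow> (\<Sum>x\<in>X. T y x * w x) = 0"
    by blast
  define g where "g = (\<Sum>m\<in>box a (t - 1). Poly_Mapping.single m (w (Inl m)))"
  define u where "u = (\<Sum>m\<in>ternary r. Poly_Mapping.single m (w (Inr m)))"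
  define q where "q = lform b * g + lform c ^ a5 * u"
  have g_hom: "g \<in> homogeneous_part (t - 1)"
    unfolding g_def by (intro hom_sum hom_single) (simp add: box_def)
  have u_hom: "u \<in> homogeneous_part (int r)"
    unfolding u_def by (intro hom_sum hom_single) (simp add: ternaryD)
  have c_hom: "lform c ^ a5 \<in> homogeneous_part (int a5)"
    using hom_power[OF hom_lform, of c a5] by simp
  have q_hom: "q \<in> homogeneous_part t"
    using hom_mult[OF hom_lform g_hom, of b] hom_mult[OF c_hom u_hom] t unfolding q_def
    by (intro hom_add) simp_all
  have q_lookup: "Poly_Mapping.lookup q y = (\<Sum>x\<in>X. T y x * w x)" for y
  proof -
    have "Poly_Mapping.lookup (lform b * g) y = (\<Sum>m\<in>box a (t - 1). T y (Inl m) * w (Inl m))"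
      unfolding g_def T_def p_def sum.case
      by (rule lookup_linear_combination[where h = "(*) (lform b)"]) (simp_all add: distrib_left mult.left_commute)
    moreover have "Poly_Mapping.lookup (lform c ^ a5 * u) y = (\<Sum>m\<in>ternary r. T y (Inr m) * w (Inr m))"
      unfolding u_def T_def p_def sum.case
      by (rule lookup_linear_combination[where h = "(*) (lform c ^ a5)"]) (simp_all add: distrib_left mult.left_commute)
    ultimately show ?thesis
      by (simp add: q_def X_def lookup_add sum.Plus)
  qed
  have q_ideal: "q \<in> monomial_ideal a"
    unfolding monomial_ideal_def
  proof (intro CollectI ballI)
    fix m assume m: "m \<in> Poly_Mapping.keys q"
    then have "m \<notin> box a t" using w(2)[of m] by (auto simp: in_keys_iff q_lookup)
    then show "\<exists>i. a i \<le> Poly_Mapping.lookup m i"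
      using m q_hom by (auto simp: box_def homogeneous_part_def not_less)
  qed
  have u_nonzero: "u \<noteq> 0"
  proof
    assume "u = 0"
    then have "lform b ^ 1 * g \<in> monomial_ideal a" using q_ideal by (simp add: q_def)
    then have g: "g \<in> monomial_ideal a"
      by (rule strong_lefschetz_inj[OF b_nonzero g_hom]) (use socle in simp)
    have "g = 0"
    proof (rule ccontr)
      assume "g \<noteq> 0"
      then obtain m where m: "m \<in> Poly_Mapping.keys g" by (auto simp flip: keys_eq_empty)
      then have "m \<in> box a (t - 1)"
        unfolding g_def by (rule subsetD[OF keys_sum_single_subset[OF finite_box]])
      moreover from m g obtain i where "a i \<le> Poly_Mapping.lookup m i" by (auto simp: monomial_ideal_def)
      moreover have "Poly_Mapping.lookup m i < a i" using \<open>m \<in> box a (t - 1)\<close> by (simp add: box_def)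
      ultimately show False by simp
    qed
    then have "\<forall>m\<in>box a (t - 1). w (Inl m) = 0"
      unfolding g_def by (intro ballI sum_single_eq_0D[where v = "\<lambda>m. w (Inl m)", OF _ finite_box])
    moreover have "\<forall>m\<in>ternary r. w (Inr m) = 0"
      using \<open>u = 0\<close> unfolding u_def
      by (intro ballI sum_single_eq_0D[where v = "\<lambda>m. w (Inr m)", OF _ finite_ternary])
    ultimately show False using w(1) by (auto simp: X_def)
  qed
  have "g - lform c ^ a5 * v \<notin> monomial_ideal a" if v: "v \<in> homogeneous_part (int r - 1)" for v
  proof
    assume "g - lform c ^ a5 * v \<in> monomial_ideal a"
    then have "q - lform b * (g - lform c ^ a5 * v) \<in> monomial_ideal a"
      by (rule monomial_ideal_diff[OF q_ideal monomial_ideal_mult])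
    then have "lform c ^ a5 * (u + lform b * v) \<in> monomial_ideal a"
      by (simp add: q_def algebra_simps)
    moreover have hom: "u + lform b * v \<in> homogeneous_part (int r)"
      using hom_mult[OF hom_lform v, of b] by (intro hom_add u_hom) simp
    ultimately have "u + lform b * v \<in> monomial_ideal a"
      using strong_lefschetz_inj[where b = c, OF c_nonzero hom, of a5 a] socle t by simp
    have "u + lform b * v = 0"
    proof (rule ccontr)
      assume "u + lform b * v \<noteq> 0"
      then obtain m where m: "m \<in> Poly_Mapping.keys (u + lform b * v)"
        by (metis all_not_in_conv keys_eq_empty)
      with \<open>u + lform b * v \<in> monomial_ideal a\<close> obtain i where "a i \<le> Poly_Mapping.lookup m i"
        by (auto simp: monomial_ideal_def)
      also have "\<dots> \<le> total_deg m" unfolding total_deg_def by (rule member_le_sum) simp_all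
      also have "total_deg m = r" using m hom by (simp add: homogeneous_part_def)
      finally show False using r(1)[of i] by simp
    qed
    then have u: "lform b * v = - u" by (simp add: eq_neg_iff_add_eq_0 add.commute)
    have "pd 4 u = 0"
      unfolding u_def by (simp add: derivation_sum[OF derivation_pd] pd_single ternaryD)
    then have "pd 4 (lform b * v) = 0"
      unfolding u by (simp add: derivation_minus[OF derivation_pd])
    from lform_mult_pd_eq_0[OF b_nonzero this] u u_nonzero show False by simp
  qed
  moreover have "lform b * g - lform c ^ a5 * (- u) \<in> monomial_ideal a"
    using q_ideal by (simp add: q_def)
  ultimately show ?thesis using g_hom by blast
qed

end

text \<open>Passing from \<open>a i\<close> and \<open>lam\<close> to \<open>a i - r\<close> and \<open>lam - 2 * r\<close> lowers the growth \<open>N\<close> of the number of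
  monomials by exactly \<open>2 * r\<close>, whereas \<open>ternary r\<close> has more than \<open>2 * r + 1\<close> elements as soon as \<open>r \<ge> 2\<close>.\<close>

lemma (in general_pair) fails_max_rank:
  assumes ord: "a1 \<le> a2" "a2 \<le> a3" "a3 \<le> a4" "a4 \<le> a5"
    and lam: "2 * lam + 5 = int (a1 + a2 + a3 + a4)" "lam = int a5 + int r"
    and r: "2 \<le> r" "r < a1"
  shows "\<not> max_rank (power_ideal a1 a2 a3 a4 a5 (lform c)) (lform b) (lam - 1)"
proof -
  define a where "a = vec4 a1 a2 a3 a4"
  define a' where "a' = (\<lambda>i. a i - r)"
  have a': "a' = vec4 (a1 - r) (a2 - r) (a3 - r) (a4 - r)"
    by (rule ext) (simp add: a'_def a_def vec4_def)
  have ra: "r < a i" for i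
  proof -
    have "\<forall>i. r < a i" unfolding all_4 using ord r by (simp add: a_def)
    then show ?thesis by blast
  qed
  have ra5: "r < a5" using ord r by simp
  define N where "N = (if a2 + a3 \<le> a1 + a4 then int (a1 + a2 + a3) - int a4 else 2 * int a1)"
  have N: "int (card (box a lam)) - int (card (box a (lam - 1))) = N"
    unfolding a_def N_def using ord lam r by (intro card_box_growth) auto
  have N': "int (card (box a' (lam - 2 * int r))) - int (card (box a' (lam - 2 * int r - 1))) = N - 2 * int r"
    unfolding a' using ord lam r by (subst card_box_growth) (auto simp: N_def)
  have "N - 2 * int r \<ge> 2"
    using ord lam r by (auto simp: N_def)
  then have "card (box a' (lam - 2 * int r - 1)) + 1 < card (box a' (lam - 2 * int r))"
    using N' by linarith
  then obtain G where G: "G \<in> apolar b a' (lam - 2 * int r)" "eval_at c G = 0" "G \<noteq> 0"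
    by (rule exists_apolar_vanishing)
  have "conic ^ r * G \<noteq> 0" using G(3) conic_nonzero by simp
  from not_surjective[OF conic_power_apolar[OF G(1)[unfolded a'_def] G(2) lam(2) ra ra5] this]
  obtain h where h: "h \<in> homogeneous_part lam"
    "\<And>f g. h - lform b * f - lform c ^ a5 * g \<notin> monomial_ideal a" by blast
  have "2 * r \<le> r * r" using r by simp
  moreover have "2 * card (ternary r) = r * r + 3 * r + 2"
    using card_ternary[of r] by (simp add: algebra_simps)
  ultimately have "2 * r + 1 < card (ternary r)" using r by linarith
  then have card: "card (box a lam) + (card (box a' (lam - 2 * int r - 1)) + 1)
      < card (box a (lam - 1)) + card (ternary r) + card (box a' (lam - 2 * int r))"
    using N N' by linarith
  have socle: "2 * lam + 1 = (\<Sum>i\<in>UNIV. int (a i) - 1)"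
    using lam(1) by (simp only: sum_4 a_def vec4_simps)
  from not_injective[OF lam(2) socle ra ra5 card[unfolded a'_def]]
  obtain g u where g: "g \<in> homogeneous_part (lam - 1)" "lform b * g - lform c ^ a5 * u \<in> monomial_ideal a"
    "\<And>v. v \<in> homogeneous_part (int r - 1) \<Longrightarrow> g - lform c ^ a5 * v \<notin> monomial_ideal a"
    by blast
  define I where "I = power_ideal a1 a2 a3 a4 a5 (lform c)"
  have "lform b * g \<in> I" using g(2) unfolding I_def power_ideal_iff a_def by blast
  moreover have "g \<notin> I"
  proof
    assume "g \<in> I"
    from power_ideal_hom[OF g(1) this[unfolded I_def]] obtain v
      where "v \<in> homogeneous_part (lam - 1 - int a5)" "g - lform c ^ a5 * v \<in> monomial_ideal a"
      unfolding a_def by blast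
    with g(3)[of v] lam(2) show False by simp
  qed
  moreover have "h - lform b * f \<notin> I" for f
    using h(2) unfolding I_def power_ideal_iff a_def by blast
  ultimately show ?thesis
    unfolding I_def power_ideal_def using h(1) g(1)
    by (subst max_rank_iff[OF hom_lform]) auto
qed

section \<open>Maximal rank\<close>

context general_pair
begin

text \<open>When the bounds \<open>a i\<close> are ordered, these four of the six brackets suffice to reach the required
  degree in each variable.\<close>

definition bracket_monomial :: "nat \<Rightarrow> nat \<Rightarrow> nat \<Rightarrow> nat \<Rightarrow> (4, 'k) mpolynomial" where
  "bracket_monomial e14 e23 e24 e34
    = bracket 1 4 ^ e14 * (bracket 2 3 ^ e23 * (bracket 2 4 ^ e24 * bracket 3 4 ^ e34))"

lemma bracket_monomial_apolar:
  assumes "int (e14 + e23 + e24 + e34) = t"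
    and deg: "e14 < a 1" "e23 + e24 < a 2" "e23 + e34 < a 3" "e14 + e24 + e34 < a 4"
  shows "bracket_monomial e14 e23 e24 e34 \<in> apolar b a t"
proof (rule apolarI)
  have pow: "bracket i j ^ n \<in> homogeneous_part (int n)" for i j n
    using hom_power[OF hom_bracket, of i j n] by simp
  show "bracket_monomial e14 e23 e24 e34 \<in> homogeneous_part t"
    unfolding bracket_monomial_def assms(1)[symmetric] of_nat_add add.assoc by (intro hom_mult pow)
  show "dir b (bracket_monomial e14 e23 e24 e34) = 0"
    by (simp add: bracket_monomial_def derivation_mult[OF derivation_dir] derivation_power[OF derivation_dir])
  have "\<forall>i. 0 < a i" unfolding all_4 using deg by auto
  then show "0 < a i" for i by blast
  have d: "degree_along_le (pd k) (n * (if k = i \<or> k = j then 1 else 0)) (bracket i j ^ n)" for k i j n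
    by (rule degree_along_le_power[OF derivation_pd degree_along_pd_bracket])
  have all: "degree_along_le (pd k) (e14 * (if k = 1 \<or> k = 4 then 1 else 0) + (e23 * (if k = 2 \<or> k = 3 then 1 else 0)
    + (e24 * (if k = 2 \<or> k = 4 then 1 else 0) + e34 * (if k = 3 \<or> k = 4 then 1 else 0)))) (bracket_monomial e14 e23 e24 e34)" for k
    unfolding bracket_monomial_def by (intro degree_along_le_mult[OF derivation_pd] d)
  have "\<forall>i. degree_along_le (pd i) (a i - 1) (bracket_monomial e14 e23 e24 e34)"
    unfolding all_4
  proof (intro conjI)
    show "degree_along_le (pd 1) (a 1 - 1) (bracket_monomial e14 e23 e24 e34)"
      by (rule degree_along_le_mono[OF derivation_pd all]) (use deg in simp)
    show "degree_along_le (pd 2) (a 2 - 1) (bracket_monomial e14 e23 e24 e34)"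
      by (rule degree_along_le_mono[OF derivation_pd all]) (use deg in simp)
    show "degree_along_le (pd 3) (a 3 - 1) (bracket_monomial e14 e23 e24 e34)"
      by (rule degree_along_le_mono[OF derivation_pd all]) (use deg in simp)
    show "degree_along_le (pd 4) (a 4 - 1) (bracket_monomial e14 e23 e24 e34)"
      by (rule degree_along_le_mono[OF derivation_pd all]) (use deg in simp)
  qed
  then show "degree_along_le (pd i) (a i - 1) (bracket_monomial e14 e23 e24 e34)" for i by blast
qed

lemma eval_bracket_nonzero: "i \<noteq> j \<Longrightarrow> eval_at c (bracket i j) \<noteq> 0"
  using minors_nonzero[of i j] by (simp add: eval_bracket)

lemma eval_bracket_monomial_nonzero: "eval_at c (bracket_monomial e14 e23 e24 e34) \<noteq> 0"
  using eval_bracket_nonzero by (simp add: bracket_monomial_def eval_at_mult eval_at_power)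

definition log_derivative :: "(4 \<Rightarrow> 'k) \<Rightarrow> (4, 'k) mpolynomial \<Rightarrow> 'k" where
  "log_derivative d f = eval_at c (dir d f) / eval_at c f"

lemma log_derivative_mult:
  "eval_at c f \<noteq> 0 \<Longrightarrow> eval_at c g \<noteq> 0 \<Longrightarrow> log_derivative d (f * g) = log_derivative d f + log_derivative d g"
  by (simp add: log_derivative_def derivation_mult[OF derivation_dir] eval_at_add eval_at_mult field_simps)

lemma log_derivative_power:
  "eval_at c f \<noteq> 0 \<Longrightarrow> log_derivative d (f ^ n) = of_nat n * log_derivative d f"
proof (induction n)
  case 0
  show ?case by (simp add: log_derivative_def derivation_1[OF derivation_dir])
next
  case (Suc n)
  then show ?case by (simp add: log_derivative_mult eval_at_power algebra_simps)
qed

lemma log_derivative_bracket_monomial: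
  "log_derivative d (bracket_monomial e14 e23 e24 e34)
    = of_nat e14 * log_derivative d (bracket 1 4) + of_nat e23 * log_derivative d (bracket 2 3)
    + of_nat e24 * log_derivative d (bracket 2 4) + of_nat e34 * log_derivative d (bracket 3 4)"
  unfolding bracket_monomial_def
  by (simp add: log_derivative_mult log_derivative_power eval_at_mult eval_at_power eval_bracket_nonzero add.assoc)

text \<open>The three forms arise from one product by removing a factor \<open>bracket 1 4\<close>, \<open>bracket 2 4\<close> or
  \<open>bracket 3 4\<close>. If their derivatives in the direction \<open>d\<close> vanish at \<open>c\<close>, then these brackets have the same
  logarithmic derivative \<open>k\<close>, which puts \<open>d\<close> into the span of \<open>b\<close> and \<open>c\<close>. But then every bracket has
  logarithmic derivative \<open>k\<close>, so that the degree of the forms times \<open>k\<close> is zero.\<close>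

lemma bracket_monomial_gradients:
  assumes d: "eval_at c (dir d (bracket_monomial e14 e23 (Suc e24) (Suc e34))) = 0"
    "eval_at c (dir d (bracket_monomial (Suc e14) e23 e24 (Suc e34))) = 0"
    "eval_at c (dir d (bracket_monomial (Suc e14) e23 (Suc e24) e34)) = 0"
  obtains s where "\<And>i. d i = s * b i"
proof -
  define l where "l i j = log_derivative d (bracket i j)" for i j
  define k where "k = l 3 4"
  have zero: "of_nat e14 * l 1 4 + of_nat e23 * l 2 3 + of_nat (Suc e24) * l 2 4 + of_nat (Suc e34) * l 3 4 = 0"
    "of_nat (Suc e14) * l 1 4 + of_nat e23 * l 2 3 + of_nat e24 * l 2 4 + of_nat (Suc e34) * l 3 4 = 0"
    "of_nat (Suc e14) * l 1 4 + of_nat e23 * l 2 3 + of_nat (Suc e24) * l 2 4 + of_nat e34 * l 3 4 = 0"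
    unfolding l_def log_derivative_bracket_monomial[symmetric] using d by (simp_all add: log_derivative_def)
  define m where "m = of_nat e14 * l 1 4 + of_nat e23 * l 2 3 + of_nat e24 * l 2 4 + of_nat e34 * l 3 4"
  have "m + (l 2 4 + l 3 4) = 0" "m + (l 1 4 + l 3 4) = 0" "m + (l 1 4 + l 2 4) = 0"
    using zero by (simp_all add: m_def algebra_simps)
  then have l: "l 1 4 = k" "l 2 4 = k"
    unfolding k_def by (metis add_left_cancel add.commute)+
  define s where "s = (d 4 - k * c 4) / b 4"
  have cross: "b 4 * d i - b i * d 4 = k * (b 4 * c i - b i * c 4)" if "i \<noteq> 4" for i
  proof -
    have "i = 1 \<or> i = 2 \<or> i = 3" using that all_4[of "\<lambda>i. i = 1 \<or> i = 2 \<or> i = 3 \<or> i = 4"] by auto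
    then have "l i 4 = k" using l by (auto simp: k_def)
    then show ?thesis
      using minors_nonzero[OF that] by (simp add: l_def log_derivative_def dir_bracket eval_bracket field_simps)
  qed
  have d_eq: "d i = k * c i + s * b i" for i
  proof (cases "i = 4")
    case True
    then show ?thesis using b_nonzero[of 4] by (simp add: s_def)
  next
    case False
    have "b 4 * s = d 4 - k * c 4" using b_nonzero[of 4] by (simp add: s_def)
    then have "b 4 * (k * c i + s * b i) = k * (b 4 * c i) + b i * (d 4 - k * c 4)"
      by (simp add: distrib_left mult.left_commute mult.commute)
    also have "\<dots> = b 4 * d i" using cross[OF False] by (simp add: algebra_simps)
    finally have "b 4 * d i = b 4 * (k * c i + s * b i)" by (rule sym)
    then show ?thesis using b_nonzero[of 4] by simp
  qed
  have "l 2 3 = k"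
  proof -
    have "b 3 * d 2 - b 2 * d 3 = k * (b 3 * c 2 - b 2 * c 3)"
      unfolding d_eq by (simp add: algebra_simps)
    moreover have "b 3 * c 2 - b 2 * c 3 \<noteq> 0" by (rule minors_nonzero) simp
    ultimately show ?thesis
      by (simp add: l_def log_derivative_def dir_bracket eval_bracket)
  qed
  then have "of_nat (e14 + e23 + Suc e24 + Suc e34) * k = 0"
    using zero(1) l by (simp add: k_def[symmetric] algebra_simps)
  then have "k = 0" by (simp only: mult_eq_0_iff of_nat_eq_0_iff) simp
  then show ?thesis using that[of s] d_eq by simp
qed

lemma pairing_lform_power_const:
  assumes "F \<in> homogeneous_part (int n)"
  shows "pairing (lform c ^ n) F = fact n * eval_at c F"
  using pairing_lform_power_mult[of c n 1 F] funpow_dir_self[OF assms, of c] pairing_const_right[of "fact n * eval_at c F"]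
  by simp

text \<open>Above the middle degree, surjectivity for \<open>A\<close> is inherited by its quotient. Below, suppose
  \<open>l * f = L ^ a5 * h\<close> in \<open>A\<close>. The degree of \<open>h\<close> is at most \<open>1\<close>. If \<open>h\<close> is constant, it vanishes, since some
  apolar form does not vanish at \<open>c\<close>; if \<open>h\<close> is linear, it is a multiple of \<open>l\<close>, since the gradients at \<open>c\<close>
  of the apolar forms are independent. In both cases the injectivity of \<open>l\<close> on \<open>A\<close> gives \<open>f \<in> I\<close>.\<close>

lemma all_max_rank:
  assumes ord: "2 \<le> a1" "a1 \<le> a2" "a2 \<le> a3" "a3 \<le> a4" "a4 \<le> a5"
    and lam: "2 * lam + 5 = int (a1 + a2 + a3 + a4)" "lam - 1 \<le> int a5"
  shows "max_rank (power_ideal a1 a2 a3 a4 a5 (lform c)) (lform b) t"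
proof -
  define a where "a = vec4 a1 a2 a3 a4"
  define I where "I = power_ideal a1 a2 a3 a4 a5 (lform c)"
  have socle: "(\<Sum>i\<in>UNIV. int (a i) - 1) = 2 * lam + 1"
    using lam(1) by (simp only: sum_4 a_def vec4_simps)
  have I: "p \<in> I \<longleftrightarrow> (\<exists>h. p - lform c ^ a5 * h \<in> monomial_ideal a)" for p
    unfolding I_def a_def by (rule power_ideal_iff)
  have inj: "f \<in> monomial_ideal a"
    if "f \<in> homogeneous_part u" "u < lam" "lform b * f \<in> monomial_ideal a" for f u
    using strong_lefschetz_inj[where b = b, OF b_nonzero that(1), of 1 a] that socle by simp
  have "(\<forall>f\<in>homogeneous_part t. lform b * f \<in> I \<longrightarrow> f \<in> I) \<or>
    (\<forall>h\<in>homogeneous_part (t + 1). \<exists>f\<in>homogeneous_part t. h - lform b * f \<in> I)"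
  proof (cases "lam \<le> t")
    case True
    have "\<exists>f\<in>homogeneous_part t. h - lform b * f \<in> I" if h: "h \<in> homogeneous_part (t + 1)" for h
    proof -
      have "\<exists>f\<in>homogeneous_part (t + 1 - 1). h - lform b * f \<in> monomial_ideal a"
        by (rule strong_lefschetz_surj[OF b_nonzero h]) (use socle True in simp)
      then obtain f where "f \<in> homogeneous_part t" "h - lform b * f \<in> monomial_ideal a" by auto
      then show ?thesis unfolding I by (intro bexI[of _ f] exI[of _ 0]) simp_all
    qed
    then show ?thesis by blast
  next
    case False
    have "f \<in> I" if f: "f \<in> homogeneous_part t" "lform b * f \<in> I" for f
    proof -
      have "lform b * f \<in> homogeneous_part (t + 1)"
        using hom_mult[OF hom_lform f(1), of b] by (simp add: add.commute)
      from power_ideal_hom[OF this f(2)[unfolded I_def]] obtain h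
        where h: "h \<in> homogeneous_part (t + 1 - int a5)" "lform b * f - lform c ^ a5 * h \<in> monomial_ideal a"
        unfolding a_def by blast
      show ?thesis
      proof (cases "t + 1 < int a5")
        case True
        then have "h = 0" using hom_neg[OF h(1)] by simp
        then have "f \<in> monomial_ideal a" using h(2) False f(1) by (intro inj[of f t]) auto
        then show ?thesis unfolding I by (intro exI[of _ 0]) simp
      next
        case ge: False
        \<comment> \<open>The exponents are determined by asking that the \<open>k\<close>-th of the three forms have degree
          \<open>a i - 1\<close> in the \<open>i\<close>-th variable for \<open>i \<noteq> k\<close>, and \<open>a k - 2\<close> in the \<open>k\<close>-th one. They are integers
          because the sum of the \<open>a i\<close> is odd.\<close>
        have odd: "odd (a1 + a2 + a3 + a4)" using lam(1) by presburger
        have "int a4 \<le> lam" using ord ge False by linarith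
        then have "a4 + 2 + 1 \<le> a1 + a2 + a3" using lam(1) by linarith
        moreover have "a1 + a3 \<noteq> a2 + a4" "a1 + a2 \<noteq> a3 + a4" using odd by presburger+
        then have "a1 + a3 + 1 \<le> a2 + a4" "a1 + a2 + 1 \<le> a3 + a4" using ord by linarith+
        moreover have half: "\<exists>e. 2 * e + p + 1 = q" if "odd (p + q)" "p + 1 \<le> q" for p q :: nat
          using that by presburger
        ultimately obtain e23 e24 e34 where
          "2 * e23 + (a4 + 2) + 1 = a1 + a2 + a3" "2 * e24 + (a1 + a3) + 1 = a2 + a4"
          "2 * e34 + (a1 + a2) + 1 = a3 + a4"
          using half[of "a4 + 2" "a1 + a2 + a3"] half[of "a1 + a3" "a2 + a4"] half[of "a1 + a2" "a3 + a4"] odd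
          by (auto simp: ac_simps)
        moreover obtain e14 where "a1 = 2 + e14" using ord(1) by (rule le_Suc_ex[elim_format]) blast
        ultimately have e: "e14 + 2 = a1" "2 * e23 + a4 + 3 = a1 + a2 + a3" "2 * e24 + a1 + a3 + 1 = a2 + a4"
          "2 * e34 + a1 + a2 + 1 = a3 + a4" by linarith+
        define F1 where "F1 = bracket_monomial e14 e23 (Suc e24) (Suc e34)"
        define F2 where "F2 = bracket_monomial (Suc e14) e23 e24 (Suc e34)"
        define F3 where "F3 = bracket_monomial (Suc e14) e23 (Suc e24) e34"
        have F: "F1 \<in> apolar b a lam" "F2 \<in> apolar b a lam" "F3 \<in> apolar b a lam"
          unfolding F1_def F2_def F3_def a_def using e lam by (auto intro!: bracket_monomial_apolar)
        have pairing0: "pairing (lform c ^ a5 * h * g) F = 0" if "F \<in> apolar b a lam" for F g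
        proof -
          have "pairing ((lform b * f - lform c ^ a5 * h) * g) F = 0"
            by (rule pairing_monomial_ideal_apolar[OF _ that])
              (use monomial_ideal_mult[OF h(2), of g] in \<open>simp add: mult.commute\<close>)
          then show ?thesis
            using pairing_lform_apolar[OF that, of "f * g"]
            by (simp add: left_diff_distrib pairing_diff_left mult.assoc)
        qed
        define n where "n = nat lam"
        have n: "int n = lam" using e lam by (simp add: n_def)
        show ?thesis
        proof (cases "t + 1 = int a5")
          case True
          define s where "s = eval_at c h"
          have "h = const s" using hom_0_eq_const[of h c] h(1) True by (simp add: s_def)
          have "a5 \<le> n" using n False True by simp
          then have "lform c ^ a5 * h * lform c ^ (n - a5) = const s * lform c ^ n"
            using \<open>h = const s\<close> by (simp add: mult_ac flip: power_add)
          with pairing0[OF F(1), of "lform c ^ (n - a5)"] have "s * pairing (lform c ^ n) F1 = 0"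
            by (simp add: pairing_const_mult_left)
          moreover have "pairing (lform c ^ n) F1 \<noteq> 0"
            using apolar_hom[OF F(1)] eval_bracket_monomial_nonzero n
            by (simp add: pairing_lform_power_const F1_def)
          ultimately have "h = 0" using \<open>h = const s\<close> by simp
          then have "f \<in> monomial_ideal a" using h(2) False f(1) by (intro inj[of f t]) auto
          then show ?thesis unfolding I by (intro exI[of _ 0]) simp
        next
          case neq: False
          with ge False lam have t: "t + 1 = int a5 + 1" "n = Suc a5" using n by auto
          then have "h \<in> homogeneous_part 1" using h(1) by simp
          define d where "d = linear_coeffs h"
          have h_eq: "h = lform d" using hom_1_eq_lform[OF \<open>h \<in> homogeneous_part 1\<close>] by (simp add: d_def)
          have grad: "eval_at c (dir d F) = 0" if "F \<in> apolar b a lam" for F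
          proof -
            have "dir d F \<in> homogeneous_part (int a5)"
              using hom_dir[OF apolar_hom[OF that], of d] n[symmetric] t by simp
            from pairing_lform_power_const[OF this] pairing0[OF that, of 1]
            show ?thesis by (simp add: h_eq mult.commute[of _ "lform d"] pairing_lform_mult)
          qed
          obtain s where s: "\<And>i. d i = s * b i"
            using bracket_monomial_gradients[OF grad[OF F(1)[unfolded F1_def]] grad[OF F(2)[unfolded F2_def]]
                grad[OF F(3)[unfolded F3_def]]] by blast
          have "h = const s * lform b"
            by (simp add: h_eq lform_def s const_mult sum_distrib_left mult.assoc)
          then have "lform b * (f - lform c ^ a5 * const s) \<in> monomial_ideal a"
            using h(2) by (simp add: algebra_simps)
          moreover have "lform c ^ a5 * const s \<in> homogeneous_part t"
            using hom_mult[OF hom_power[OF hom_lform, of c a5] hom_const, of s] t by simp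
          moreover from this have "f - lform c ^ a5 * const s \<in> homogeneous_part t"
            by (rule hom_diff[OF f(1)])
          ultimately have "f - lform c ^ a5 * const s \<in> monomial_ideal a"
            using inj False not_le by blast
          then show ?thesis unfolding I by blast
        qed
      qed
    qed
    then show ?thesis by blast
  qed
  then show ?thesis
    unfolding I_def power_ideal_def by (subst max_rank_iff[OF hom_lform])
qed

end

theorem theorem3p5:
  fixes a1 a2 a3 a4 a5 :: nat
    and lam :: int
    and I :: "(4, 'k::field_char_0) mpolynomial \<Rightarrow> (4, 'k) mpolynomial set"
  assumes "2 \<le> a1" "a1 \<le> a2" "a2 \<le> a3" "a3 \<le> a4" "a4 \<le> a5"
    and "odd (a1 + a2 + a3 + a4)"
    and "lam = (int a1 + int a2 + int a3 + int a4 - 5) div 2"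
    and "I = power_ideal a1 a2 a3 a4 a5"
  shows
    "(int a5 \<ge> lam - 1 \<longrightarrow>
        for_general_linear_form (\<lambda>L. has_WLP (I L))) \<and>
     (int a5 < lam - 1 \<and> a1 + a4 \<ge> a2 + a3 \<longrightarrow>
        for_general_linear_form (\<lambda>L. fails_WLP_to (I L) lam) \<and> a1 \<ge> 5) \<and>
     (int a5 < lam - 1 \<and> a1 + a4 < a2 + a3 \<and>
      2 * int a5 + 3 - int a4 - int a3 - int a2 + int a1 \<ge> 0 \<longrightarrow>
        for_general_linear_form (\<lambda>L. fails_WLP_to (I L) lam) \<and> a1 \<ge> 3)"
proof -
  have "even (int (a1 + a2 + a3 + a4) - 5)" using assms(6) by simp
  then have lam: "2 * lam + 5 = int (a1 + a2 + a3 + a4)" using assms(7) by simp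
  have fails: "for_general_linear_form (\<lambda>L. fails_WLP_to (I L) lam)"
    if "int a5 < lam - 1" "lam - int a5 < int a1"
  proof -
    define r where "r = nat (lam - int a5)"
    have r: "lam = int a5 + int r" "2 \<le> r" "r < a1" using that by (auto simp: r_def)
    show ?thesis
      unfolding fails_WLP_to_def assms(8)
      by (intro for_general_pair general_pair.fails_max_rank[OF _ assms(2-5) lam r])
  qed
  have wlp: "for_general_linear_form (\<lambda>L. has_WLP (I L))" if "lam - 1 \<le> int a5"
    unfolding has_WLP_def assms(8)
    by (intro for_general_pair allI general_pair.all_max_rank[OF _ assms(1-5) lam that])
  show ?thesis
  proof (intro conjI impI)
    assume "lam - 1 \<le> int a5"
    then show "for_general_linear_form (\<lambda>L. has_WLP (I L))" by (rule wlp)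
  next
    assume *: "int a5 < lam - 1 \<and> a2 + a3 \<le> a1 + a4"
    then have "lam - int a5 + 3 \<le> int a1" using lam assms(2-5) by auto
    with * fails show "for_general_linear_form (\<lambda>L. fails_WLP_to (I L) lam)" "5 \<le> a1" by auto
  next
    assume *: "int a5 < lam - 1 \<and> a1 + a4 < a2 + a3 \<and>
      2 * int a5 + 3 - int a4 - int a3 - int a2 + int a1 \<ge> 0"
    then have "lam - int a5 < int a1" using lam by auto
    with * fails show "for_general_linear_form (\<lambda>L. fails_WLP_to (I L) lam)" "3 \<le> a1" by auto
  qed
qed

end
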